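(* For every integer $L\geq 1$, $$\int_{0}^{1}x^{L}\,\mathrm{d}?(x)=\frac{1}{(L-1)!}\sum_{\ell=0}^{\infty}\ \int_{[0,\infty)^{\ell+1}}x_{0}^{L}\cdot\frac{(x_{0}x_{\ell})^{-1/2}\prod_{i=0}^{\ell-1}I_{1}\big(2\sqrt{x_{i}x_{i+1}}\big)}{\prod_{i=0}^{\ell}e^{x_{i}}(2e^{x_{i}}-1)}\,\mathrm{d}x_{0}\cdots\mathrm{d}x_{\ell},$$ where for $\ell=0$ the empty product $\prod_{i=0}^{-1}$ is $1$. Moreover, the $\ell$-th term of this series is $\ll 2^{-\ell}$.
   Context: The Minkowski question mark function $?:[0,1]\to[0,1]$ is defined by $?([0,a_{1},a_{2},a_{3},\ldots])=2^{1-a_{1}}-2^{1-(a_{1}+a_{2})}+2^{1-(a_{1}+a_{2}+a_{3})}-\cdots$, where $x=[0,a_1,a_2,\ldots]$ is the regular continued fraction expansion of $x$ (for rational $x$ both expansions give the same value). It is a continuous strictly increasing bijection of $[0,1]$, and the integral is a Riemann–Stieltjes integral. $I_{1}(x)=J_{1}(ix)$ denotes the modified Bessel function of the first kind, $I_1(x)=\sum_{k\ge0}\frac{(x/2)^{2k+1}}{k!(k+1)!}$. *)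

theory Defs
  imports "HOL-Analysis.Analysis"
begin

text \<open>
  Regular continued fraction of \<open>x \<in> [0,1]\<close>: \<open>cf_rem x n\<close> is the \<open>n\<close>-th iterate of the Gauss map and
  \<open>cf_digit x n\<close> is \<open>a\<^sub>n\<^sub>+\<^sub>1\<close> in \<open>x = [0, a\<^sub>1, a\<^sub>2, \<dots>]\<close>. The expansion stops as soon as
  \<open>cf_rem x n = 0\<close>; since \<open>1 / 0 = 0\<close>, all later remainders are then \<open>0\<close> as well.
\<close>

primrec cf_rem :: "real \<Rightarrow> nat \<Rightarrow> real" where
  "cf_rem x 0 = x"
| "cf_rem x (Suc n) = frac (1 / cf_rem x n)"

definition cf_digit :: "real \<Rightarrow> nat \<Rightarrow> int" where
  "cf_digit x n = \<lfloor>1 / cf_rem x n\<rfloor>"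

definition minkowski_qm :: "real \<Rightarrow> real" where
  "minkowski_qm x =
     (\<Sum>n. if cf_rem x n = 0 then 0
          else (-1) ^ n * 2 powi (1 - (\<Sum>i\<le>n. cf_digit x i)))"

text \<open>
  Riemann--Stieltjes integral of \<open>f\<close> with respect to \<open>g\<close> over \<open>[a,b]\<close>. The gauge is constant,
  so this is the limit of Riemann--Stieltjes sums as the mesh tends to \<open>0\<close>, not the
  Henstock--Kurzweil variant; \<open>Inf K\<close> and \<open>Sup K\<close> are the endpoints of the subinterval \<open>K\<close>.
\<close>

definition has_rs_integral ::
    "(real \<Rightarrow> real) \<Rightarrow> (real \<Rightarrow> real) \<Rightarrow> real \<Rightarrow> real \<Rightarrow> real \<Rightarrow> bool" where
  "has_rs_integral f g a b I \<longleftrightarrow>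
     (\<forall>\<epsilon>>0. \<exists>\<delta>>0. \<forall>p. p tagged_division_of {a..b} \<and> (\<lambda>x. ball x \<delta>) fine p \<longrightarrow>
        \<bar>(\<Sum>(x, K)\<in>p. f x * (g (Sup K) - g (Inf K))) - I\<bar> < \<epsilon>)"

definition bessel_I1 :: "real \<Rightarrow> real" where
  "bessel_I1 x = (\<Sum>k. (x / 2) ^ (2 * k + 1) / (fact k * fact (k + 1)))"

definition moment_integrand :: "nat \<Rightarrow> nat \<Rightarrow> (nat \<Rightarrow> real) \<Rightarrow> real" where
  "moment_integrand L l x =
     x 0 ^ L *
     ((x 0 * x l) powr (-1/2) * (\<Prod>i<l. bessel_I1 (2 * sqrt (x i * x (i + 1)))) /
      (\<Prod>i\<le>l. exp (x i) * (2 * exp (x i) - 1)))"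

text \<open>Points of \<open>[0,\<infinity>)\<^bsup>l+1\<^esup>\<close> are extensional functions on the index set \<open>{0, \<dots>, l}\<close>.\<close>

abbreviation lborel_n :: "nat \<Rightarrow> (nat \<Rightarrow> real) measure" where
  "lborel_n l \<equiv> \<Pi>\<^sub>M i\<in>{..l}. lborel"

abbreviation orthant :: "nat \<Rightarrow> (nat \<Rightarrow> real) set" where
  "orthant l \<equiv> {..l} \<rightarrow>\<^sub>E {0..}"

definition moment_term :: "nat \<Rightarrow> nat \<Rightarrow> real" where
  "moment_term L l = (LINT x:orthant l|lborel_n l. moment_integrand L l x)"

end

theory Submission
  imports Defs "HOL-Probability.Distributions"
begin

text \<open>
  Let \<open>Q\<close> be the inverse of \<open>?\<close>, so that \<open>\<integral> f d? = \<integral>\<^sub>0\<^sup>1 f(Q u) du\<close>. The identity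
  \<open>?(1/(a+y)) = 2\<^bsup>1-a\<^esup> - 2\<^bsup>-a\<^esup> ?(y)\<close> says that \<open>d?\<close> is the law of \<open>1/(a+y)\<close> with \<open>a\<close> geometric and \<open>y\<close>
  an independent copy; moreover \<open>d?\<close> is invariant under \<open>x \<mapsto> 1 - x\<close>. Since \<open>e\<^bsup>t/p\<^esup> - 1\<close> is the
  Laplace transform at \<open>p\<close> of \<open>s \<mapsto> \<surd>(t/s) I\<^sub>1(2\<surd>(ts))\<close>, the function \<open>M(t) = \<integral> e\<^bsup>tx\<^esup> d?(x)\<close> satisfies
  \<open>M = 1 + K M\<close>, where \<open>K\<close> has the positive kernel \<open>\<surd>(t/s) I\<^sub>1(2\<surd>(ts)) / (e\<^sup>s(2e\<^sup>s - 1))\<close>. Likewise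
  \<open>(L-1)! \<integral> x\<^sup>L d?(x)\<close> is the integral of \<open>s\<^bsup>L-1\<^esup> M(s) / (e\<^sup>s(2e\<^sup>s - 1))\<close>, and expanding \<open>M\<close> into the
  Neumann series of \<open>K\<close> gives the formula. The rate \<open>2\<^bsup>-l\<^esup>\<close> comes from \<open>K h \<le> h / 2\<close> for \<open>h(s) = e\<^sup>s - 1\<close>.
\<close>

subsection \<open>The question mark function\<close>

lemma cf_rem_Suc_shift: "cf_rem x (Suc n) = cf_rem (frac (1 / x)) n"
  by (induction n) simp_all

lemma cf_digit_Suc_shift: "cf_digit x (Suc n) = cf_digit (frac (1 / x)) n"
  unfolding cf_digit_def cf_rem_Suc_shift ..

lemma cf_rem_bounds:
  assumes "x \<in> {0..1}"
  shows "cf_rem x n \<in> {0..1}"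
  using assms
proof (induction n)
  case (Suc n)
  show ?case by (auto intro: less_imp_le frac_lt_1)
qed simp

lemma cf_rem_nonzero:
  assumes "cf_rem x n \<noteq> 0" "i \<le> n"
  shows "cf_rem x i \<noteq> 0"
proof
  assume "cf_rem x i = 0"
  then have "cf_rem x (i + k) = 0" for k by (induction k) auto
  from this[of "n - i"] show False using assms by simp
qed

lemma cf_digit_ge_1:
  assumes "x \<in> {0..1}" "cf_rem x n \<noteq> 0"
  shows "cf_digit x n \<ge> 1"
proof -
  have "0 < cf_rem x n" "cf_rem x n \<le> 1" using cf_rem_bounds[OF assms(1), of n] assms(2) by auto
  then show ?thesis by (simp add: cf_digit_def le_floor_iff)
qed

definition qm_term :: "real \<Rightarrow> nat \<Rightarrow> real" where
  "qm_term x n = (if cf_rem x n = 0 then 0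
     else (-1) ^ n * 2 powi (1 - (\<Sum>i\<le>n. cf_digit x i)))"

lemma minkowski_qm_eq: "minkowski_qm x = (\<Sum>n. qm_term x n)"
  by (simp add: minkowski_qm_def qm_term_def)

text \<open>Every digit before the expansion stops is at least 1, so the exponent drops by at least
  1 per term.\<close>

lemma abs_qm_term_le:
  assumes "x \<in> {0..1}"
  shows "\<bar>qm_term x n\<bar> \<le> (1 / 2) ^ n"
proof (cases "cf_rem x n = 0")
  case False
  have "(\<Sum>i\<le>n. 1) \<le> (\<Sum>i\<le>n. cf_digit x i)"
    using assms False by (intro sum_mono cf_digit_ge_1 cf_rem_nonzero[OF False]) auto
  then have "1 - (\<Sum>i\<le>n. cf_digit x i) \<le> - int n" by simp
  then have "(2::real) powi (1 - (\<Sum>i\<le>n. cf_digit x i)) \<le> 2 powi (- int n)"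
    by (rule power_int_increasing) simp
  also have "\<dots> = (1 / 2) ^ n" by (simp add: power_int_minus power_one_over inverse_eq_divide)
  finally show ?thesis using False by (simp add: qm_term_def abs_mult power_abs)
qed (simp add: qm_term_def)

lemma summable_qm_term:
  assumes "x \<in> {0..1}"
  shows "summable (qm_term x)"
  by (rule summable_comparison_test[OF _ summable_geometric[of "1/2::real"]])
     (use abs_qm_term_le[OF assms] in auto)

text \<open>Removing the first digit a shifts the sequence, which flips all signs and multiplies the
  tail by 2^(-a). If 1/x is an integer, the tail is \<open>minkowski_qm 0 = 0\<close>, so finite
  expansions are covered too.\<close>

lemma minkowski_qm_rec:
  assumes "0 < x" "x \<le> 1"
  shows "minkowski_qm x =
    2 powi (1 - \<lfloor>1 / x\<rfloor>) - 2 powi (- \<lfloor>1 / x\<rfloor>) * minkowski_qm (frac (1 / x))"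
proof -
  let ?y = "frac (1 / x)" and ?a = "\<lfloor>1 / x\<rfloor>"
  have y: "?y \<in> {0..1}" by (auto intro: less_imp_le frac_lt_1)
  have "qm_term x (Suc n) = - (2 powi (- ?a)) * qm_term ?y n" for n
  proof -
    have "(\<Sum>i\<le>Suc n. cf_digit x i) = ?a + (\<Sum>i\<le>n. cf_digit ?y i)"
      unfolding sum.atMost_Suc_shift cf_digit_Suc_shift by (simp add: cf_digit_def)
    then have "(2::real) powi (1 - (\<Sum>i\<le>Suc n. cf_digit x i))
        = 2 powi (- ?a) * 2 powi (1 - (\<Sum>i\<le>n. cf_digit ?y i))"
      by (subst power_int_add[symmetric]) (simp_all del: sum.atMost_Suc add: algebra_simps)
    then show ?thesis by (simp add: qm_term_def cf_rem_Suc_shift del: cf_rem.simps(2) sum.atMost_Suc)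
  qed
  moreover have "qm_term x 0 = 2 powi (1 - ?a)" using assms by (simp add: qm_term_def cf_digit_def)
  moreover have "minkowski_qm x = qm_term x 0 + (\<Sum>n. qm_term x (Suc n))"
    using suminf_split_head[OF summable_qm_term[of x]] assms unfolding minkowski_qm_eq by simp
  moreover have "(\<Sum>n. - (2 powi (- ?a)) * qm_term ?y n) = - (2 powi (- ?a)) * minkowski_qm ?y"
    unfolding minkowski_qm_eq by (rule suminf_mult[OF summable_qm_term[OF y]])
  ultimately have "minkowski_qm x = 2 powi (1 - ?a) + - (2 powi (- ?a)) * minkowski_qm ?y"
    by (simp only:)
  then show ?thesis by linarith
qed

lemma minkowski_qm_0 [simp]: "minkowski_qm 0 = 0"
proof -
  have "cf_rem 0 n = 0" for n by (induction n) auto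
  then show ?thesis by (simp add: minkowski_qm_def)
qed

lemma minkowski_qm_1 [simp]: "minkowski_qm 1 = 1"
  using minkowski_qm_rec[of 1] by simp

text \<open>This is the recursion read from the inverse branches of the Gauss map; the variable
  \<open>n\<close> stands for the first digit minus 1. The closed endpoint y = 1 is included so that
  the branches fit together.\<close>

lemma minkowski_qm_branch:
  assumes "0 \<le> y" "y \<le> 1"
  shows "minkowski_qm (1 / (real n + 1 + y)) = (1 / 2) ^ n - (1 / 2) ^ Suc n * minkowski_qm y"
proof -
  have powi: "(2::real) powi (- int k) = (1 / 2) ^ k" for k
    by (simp add: power_int_minus power_one_over inverse_eq_divide)
  show ?thesis
  proof (cases "y = 1")
    \<comment> \<open>For y = 1 the computed first digit of 1/(n+2) is n + 2 with remainder 0, not n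
      + 1 with remainder 1. Both expansions give (1/2)^(n+1).\<close>
    case True
    have fl: "\<lfloor>real n + 2\<rfloor> = int n + 2" by linarith
    then have fr: "frac (real n + 2) = 0" by (simp add: frac_def)
    have "1 - (int n + 2) = - int (Suc n)" by simp
    then have "minkowski_qm (1 / (real n + 2)) = (1 / 2) ^ Suc n"
      using minkowski_qm_rec[of "1 / (real n + 2)"]
      by (simp only: fl fr powi minkowski_qm_0 div_by_1 divide_divide_eq_right mult_1) simp
    then show ?thesis using True by (simp add: add.assoc)
  next
    case False
    then have fl: "\<lfloor>real n + 1 + y\<rfloor> = int n + 1" using assms by linarith
    then have fr: "frac (real n + 1 + y) = y" by (simp add: frac_def)
    have "1 - (int n + 1) = - int n" "- (int n + 1) = - int (Suc n)" by simp_all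
    then show ?thesis
      using minkowski_qm_rec[of "1 / (real n + 1 + y)"] assms
      by (simp only: fl fr powi div_by_1 divide_divide_eq_right mult_1) simp
  qed
qed

lemma minkowski_qm_right:
  assumes "y \<in> {0..1}"
  shows "minkowski_qm (1 / (1 + y)) = 1 - minkowski_qm y / 2"
  using minkowski_qm_branch[of y 0] assms by simp

lemma cf_branch:
  assumes "0 < x" "x \<le> 1"
  obtains n y where "0 \<le> y" "y \<le> 1" "x = 1 / (real n + 1 + y)"
proof
  define a where "a = \<lfloor>1 / x\<rfloor>"
  have "a \<ge> 1" using assms by (simp add: a_def le_floor_iff)
  then have "1 / x = real (nat (a - 1)) + 1 + frac (1 / x)" by (simp add: a_def frac_def)
  then show "x = 1 / (real (nat (a - 1)) + 1 + frac (1 / x))"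
    by (simp flip: \<open>1 / x = real (nat (a - 1)) + 1 + frac (1 / x)\<close>)
qed (auto intro: less_imp_le frac_lt_1)

text \<open>Since (1+x)/x = 1 + 1/x, the map x/(1+x) raises the first digit by 1 and leaves the
  others alone. Together with \<open>minkowski_qm_right\<close> it describes the function on the two
  halves of [0,1].\<close>

lemma minkowski_qm_left:
  assumes "x \<in> {0..1}"
  shows "minkowski_qm (x / (1 + x)) = minkowski_qm x / 2"
proof (cases "x = 0")
  case False
  then obtain n y where y: "0 \<le> y" "y \<le> 1" and x: "x = 1 / (real n + 1 + y)"
    using cf_branch[of x] assms by (metis atLeastAtMost_iff less_le)
  have "x / (1 + x) = 1 / (real (Suc n) + 1 + y)" using y unfolding x by (simp add: field_simps)
  then have "minkowski_qm (x / (1 + x)) = (1 / 2) ^ Suc n - (1 / 2) ^ Suc (Suc n) * minkowski_qm y"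
    using minkowski_qm_branch[OF y, of "Suc n"] by simp
  moreover have "minkowski_qm x = (1 / 2) ^ n - (1 / 2) ^ Suc n * minkowski_qm y"
    using minkowski_qm_branch[OF y, of n] unfolding x .
  ultimately show ?thesis by (simp add: diff_divide_distrib)
qed simp

text \<open>With u = x/(1-x) one has x = u/(1+u) and 1 - x = 1/(1+u): the left branch at u gives x,
  the right branch at the same u gives 1 - x. The reflection symmetry follows from this
  coincidence.\<close>

lemma left_half_stretch:
  fixes x :: real
  assumes "0 \<le> x" "x \<le> 1 / 2"
  shows "x / (1 - x) \<in> {0..1}" "minkowski_qm x = minkowski_qm (x / (1 - x)) / 2"
    "minkowski_qm (1 - x) = 1 - minkowski_qm (x / (1 - x)) / 2"
proof -
  show *: "x / (1 - x) \<in> {0..1}" using assms by (simp add: divide_le_eq)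
  have "1 + x / (1 - x) = 1 / (1 - x)" using assms by (simp add: add_divide_eq_iff)
  then have "x / (1 - x) / (1 + x / (1 - x)) = x" "1 / (1 + x / (1 - x)) = 1 - x"
    using assms by simp_all
  then show "minkowski_qm x = minkowski_qm (x / (1 - x)) / 2"
    "minkowski_qm (1 - x) = 1 - minkowski_qm (x / (1 - x)) / 2"
    using minkowski_qm_left[OF *] minkowski_qm_right[OF *] by (simp_all only:)
qed

lemma right_half_stretch:
  fixes x :: real
  assumes "1 / 2 \<le> x" "x \<le> 1"
  shows "1 / x - 1 \<in> {0..1}" "minkowski_qm x = 1 - minkowski_qm (1 / x - 1) / 2"
proof -
  have "1 \<le> 1 / x" "1 / x \<le> 2" using assms by (simp_all add: le_divide_eq divide_le_eq)
  then show *: "1 / x - 1 \<in> {0..1}" by simp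
  have "1 + (1 / x - 1) = 1 / x" by linarith
  then have "1 / (1 + (1 / x - 1)) = x" by (simp only: divide_divide_eq_right mult_1 div_by_1)
  then show "minkowski_qm x = 1 - minkowski_qm (1 / x - 1) / 2"
    using minkowski_qm_right[OF *] by (simp only:)
qed

lemma minkowski_qm_reflect:
  assumes "x \<in> {0..1}"
  shows "minkowski_qm (1 - x) = 1 - minkowski_qm x"
proof -
  have *: "minkowski_qm (1 - x) = 1 - minkowski_qm x" if x: "0 \<le> x" "x \<le> 1 / 2" for x
    using left_half_stretch(2,3)[OF x] by simp
  have "minkowski_qm (1 - x) = 1 - minkowski_qm x" if "x \<le> 1 / 2"
    using *[OF _ that] assms by simp
  moreover have "minkowski_qm (1 - x) = 1 - minkowski_qm x" if "\<not> x \<le> 1 / 2"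
    using *[of "1 - x"] that assms by simp
  ultimately show ?thesis by blast
qed

section \<open>Range, strict monotonicity and uniform continuity\<close>

lemma abs_minkowski_qm_le:
  assumes "x \<in> {0..1}"
  shows "\<bar>minkowski_qm x\<bar> \<le> 2"
proof -
  have "norm (\<Sum>n. qm_term x n) \<le> (\<Sum>n. (1 / 2) ^ n)"
    by (rule norm_suminf_le) (use abs_qm_term_le[OF assms] in auto)
  then show ?thesis by (simp add: minkowski_qm_eq suminf_geometric)
qed

text \<open>Inequalities for the question mark function are first proved with an error that is
  halved by each passage to a half of [0,1]; here the error is removed.\<close>

lemma real_le_of_halves:
  fixes a b c :: real
  assumes "\<And>n. a \<le> b + c * (1 / 2) ^ n"
  shows "a \<le> b"
proof -
  have "(\<lambda>n. b + c * (1 / 2) ^ n) \<longlonglongrightarrow> b + c * 0"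
    by (intro tendsto_intros LIMSEQ_realpow_zero) auto
  then show ?thesis using assms by (intro LIMSEQ_le_const[of _ b]) auto
qed

text \<open>Starting from the crude bound 2, each stretch of a half of [0,1] to the whole interval
  halves the violation of the bounds.\<close>

lemma minkowski_qm_bounds:
  assumes "x \<in> {0..1}"
  shows "0 \<le> minkowski_qm x" "minkowski_qm x \<le> 1"
proof -
  have *: "- (2 * (1 / 2) ^ n) \<le> minkowski_qm x \<and> minkowski_qm x \<le> 1 + 2 * (1 / 2) ^ n"
    if "x \<in> {0..1}" for x n
    using that
  proof (induction n arbitrary: x)
    case 0
    then have "\<bar>minkowski_qm x\<bar> \<le> 2" by (rule abs_minkowski_qm_le)
    then show ?case by (simp add: abs_le_iff)
  next
    case (Suc n)
    show ?case
    proof (cases "x \<le> 1 / 2")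
      case True
      then have x: "0 \<le> x" "x \<le> 1 / 2" using Suc.prems by simp_all
      show ?thesis
        using Suc.IH[OF left_half_stretch(1)[OF x]] unfolding left_half_stretch(2)[OF x] by simp
    next
      case False
      then have x: "1 / 2 \<le> x" "x \<le> 1" using Suc.prems by simp_all
      show ?thesis
        using Suc.IH[OF right_half_stretch(1)[OF x]] unfolding right_half_stretch(2)[OF x] by simp
    qed
  qed
  have "0 \<le> minkowski_qm x + 2 * (1 / 2) ^ n" for n using *[OF assms, of n] by linarith
  then show "0 \<le> minkowski_qm x" by (rule real_le_of_halves)
  show "minkowski_qm x \<le> 1"
    by (rule real_le_of_halves[where c = 2]) (use *[OF assms] in simp)
qed

lemma minkowski_qm_le_half:
  assumes "0 \<le> x" "x \<le> 1 / 2"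
  shows "minkowski_qm x \<le> 1 / 2"
  unfolding left_half_stretch(2)[OF assms]
  using minkowski_qm_bounds[OF left_half_stretch(1)[OF assms]] by simp

lemma minkowski_qm_ge_half:
  assumes "1 / 2 \<le> x" "x \<le> 1"
  shows "1 / 2 \<le> minkowski_qm x"
  unfolding right_half_stretch(2)[OF assms]
  using minkowski_qm_bounds[OF right_half_stretch(1)[OF assms]] by simp

text \<open>The error is halved if both points lie in one half of [0,1]. On the right half the
  stretch 1/x - 1 reverses the order, and the minus sign in the functional equation restores it.
  Points in different halves are separated by the value 1/2.\<close>

lemma minkowski_qm_mono:
  assumes "0 \<le> x" "x \<le> y" "y \<le> 1"
  shows "minkowski_qm x \<le> minkowski_qm y"
proof -
  have *: "minkowski_qm x \<le> minkowski_qm y + (1 / 2) ^ n" if "0 \<le> x" "x \<le> y" "y \<le> 1" for n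
    using that
  proof (induction n arbitrary: x y)
    case 0
    then show ?case using minkowski_qm_bounds[of x] minkowski_qm_bounds[of y] by auto
  next
    case (Suc n)
    consider "y \<le> 1 / 2" | "1 / 2 \<le> x" | "x \<le> 1 / 2" "1 / 2 \<le> y" by linarith
    then show ?case
    proof cases
      case 1
      define u where "u = x / (1 - x)"
      have xh: "0 \<le> x" "x \<le> 1 / 2" using Suc.prems 1 by simp_all
      note u = left_half_stretch[OF xh, folded u_def]
      define v where "v = y / (1 - y)"
      have yh: "0 \<le> y" "y \<le> 1 / 2" using 1 Suc.prems by simp_all
      note v = left_half_stretch[OF yh, folded v_def]
      have "u \<le> v" unfolding u_def v_def using Suc.prems 1 by (intro frac_le) auto
      then show ?thesis
        using Suc.IH[of u v] u(1,2) v(1,2) by simp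
    next
      case 2
      define u where "u = 1 / x - 1"
      have xh: "1 / 2 \<le> x" "x \<le> 1" using Suc.prems 2 by simp_all
      note u = right_half_stretch[OF xh, folded u_def]
      define v where "v = 1 / y - 1"
      have yh: "1 / 2 \<le> y" "y \<le> 1" using 2 Suc.prems by simp_all
      note v = right_half_stretch[OF yh, folded v_def]
      have "v \<le> u" unfolding u_def v_def using Suc.prems 2 by (auto intro!: frac_le)
      then show ?thesis
        using Suc.IH[of v u] u(1,2) v(1,2) by simp
    next
      case 3
      then have "minkowski_qm x \<le> minkowski_qm y"
        using minkowski_qm_le_half[of x] minkowski_qm_ge_half[of y] Suc.prems by simp
      then show ?thesis by (simp add: add_increasing2)
    qed
  qed
  show ?thesis by (rule real_le_of_halves[where c = 1]) (use *[OF assms] in simp)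
qed

lemma minkowski_qm_pos:
  assumes "0 < x" "x \<le> 1"
  shows "0 < minkowski_qm x"
proof -
  obtain n y where y: "0 \<le> y" "y \<le> 1" "x = 1 / (real n + 1 + y)" using cf_branch assms by blast
  have "(1 / 2) ^ Suc n * minkowski_qm y \<le> (1 / 2) ^ Suc n"
    using minkowski_qm_bounds[of y] y by (intro mult_left_le) auto
  also have "\<dots> < (1 / 2) ^ n" by simp
  finally show ?thesis using minkowski_qm_branch[OF y(1,2), of n] y(3) by simp
qed

lemma minkowski_qm_less_1:
  assumes "0 \<le> x" "x < 1"
  shows "minkowski_qm x < 1"
  using minkowski_qm_pos[of "1 - x"] minkowski_qm_reflect[of x] assms by simp

text \<open>Both inverse branches \<open>x / (1 - x)\<close> and \<open>1 / x - 1\<close> stretch an interval of length \<open>d\<close>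
  to length at least \<open>d / (1 - d)\<close>, so the reciprocal of the length drops by at least \<open>1\<close>.\<close>

lemma minkowski_qm_strict_mono:
  assumes "0 \<le> x" "x < y" "y \<le> 1"
  shows "minkowski_qm x < minkowski_qm y"
proof -
  \<comment> \<open>If 1/d is at most n + 1 and D is at least d/(1-c) with d at most c, then 1/D is
    at most n. Below, d is the old length, D the new one, and c is y in the left half and 1 - x in
    the right half.\<close>
  have len: "1 \<le> real n * D"
    if d: "0 < d" "d \<le> c" "c < 1" "1 \<le> real (Suc n) * d" and D: "d / (1 - c) \<le> D"
    for d c D :: real and n
  proof -
    have "1 - d \<le> real n * d" using d(4) by (simp add: algebra_simps)
    then have "1 \<le> real n * (d / (1 - d))" using d by (simp add: field_simps)
    also have "\<dots> \<le> real n * (d / (1 - c))" using d by (intro mult_left_mono divide_left_mono) auto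
    also have "\<dots> \<le> real n * D" using D by (intro mult_left_mono) auto
    finally show ?thesis .
  qed
  \<comment> \<open>Induction on an integer bound for the reciprocal of the length; for
    \<open>n = 0\<close> the last hypothesis is contradictory.\<close>
  have *: "minkowski_qm x < minkowski_qm y"
    if "0 \<le> x" "x < y" "y \<le> 1" "1 \<le> real n * (y - x)" for n
    using that
  proof (induction n arbitrary: x y)
    case (Suc n)
    consider "y \<le> 1 / 2" | "1 / 2 \<le> x" | "x < 1 / 2" "1 / 2 < y" by linarith
    then show ?case
    proof cases
      case 1
      define u where "u = x / (1 - x)"
      have xh: "0 \<le> x" "x \<le> 1 / 2" using Suc.prems 1 by simp_all
      note u = left_half_stretch[OF xh, folded u_def]
      define v where "v = y / (1 - y)"
      have yh: "0 \<le> y" "y \<le> 1 / 2" using 1 Suc.prems by simp_all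
      note v = left_half_stretch[OF yh, folded v_def]
      have "v - u = (y - x) / ((1 - x) * (1 - y))"
        unfolding u_def v_def using Suc.prems 1 by (simp add: field_simps)
      also have "\<dots> \<ge> (y - x) / (1 - y)" using Suc.prems 1
        by (intro divide_left_mono) (auto intro: mult_left_le_one_le)
      finally have *: "(y - x) / (1 - y) \<le> v - u" .
      have "1 \<le> real n * (v - u)" by (rule len[OF _ _ _ _ *]) (use Suc.prems 1 in auto)
      moreover have "0 < (y - x) / (1 - y)" using Suc.prems 1 by simp
      then have "u < v" using * by simp
      ultimately show ?thesis
        using Suc.IH[of u v] u(1,2) v(1,2) by simp
    next
      case 2
      define u where "u = 1 / x - 1"
      have xh: "1 / 2 \<le> x" "x \<le> 1" using Suc.prems 2 by simp_all
      note u = right_half_stretch[OF xh, folded u_def]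
      define v where "v = 1 / y - 1"
      have yh: "1 / 2 \<le> y" "y \<le> 1" using 2 Suc.prems by simp_all
      note v = right_half_stretch[OF yh, folded v_def]
      have "u - v = (y - x) / (x * y)"
        unfolding u_def v_def using Suc.prems 2 by (simp add: field_simps)
      also have "\<dots> \<ge> (y - x) / x" using Suc.prems 2
        by (intro divide_left_mono) (auto intro: mult_right_le_one_le)
      finally have *: "(y - x) / (1 - (1 - x)) \<le> u - v" by simp
      have "1 \<le> real n * (u - v)" by (rule len[OF _ _ _ _ *]) (use Suc.prems 2 in auto)
      moreover have "0 < (y - x) / (1 - (1 - x))" using Suc.prems 2 by simp
      then have "v < u" using * by simp
      ultimately show ?thesis
        using Suc.IH[of v u] u(1,2) v(1,2) by simp
    next
      case 3
      define u where "u = x / (1 - x)"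
      have xh: "0 \<le> x" "x \<le> 1 / 2" using Suc.prems 3 by simp_all
      note u = left_half_stretch[OF xh, folded u_def]
      have "u < 1" unfolding u_def using 3 by (simp add: field_simps)
      then have "minkowski_qm x < 1 / 2"
        using minkowski_qm_less_1[of u] u(1,2) by simp
      also have "1 / 2 \<le> minkowski_qm y" using minkowski_qm_ge_half[of y] 3 Suc.prems by simp
      finally show ?thesis .
    qed
  qed simp
  obtain n where "1 / (y - x) \<le> real n" using real_arch_simple by blast
  then have "1 \<le> real n * (y - x)" using assms by (simp add: field_simps)
  then show ?thesis using * assms by blast
qed

text \<open>Within one half of [0,1] the stretch enlarges lengths at most fourfold and halves the
  increment, so a quarter of the old \<open>\<delta>\<close> serves. An interval across 1/2 is cut
  there, and each piece is estimated by the decay of the function near 0.\<close>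

lemma minkowski_qm_uniform:
  "\<exists>\<delta>>0. \<forall>x\<in>{0..1}. \<forall>y\<in>{0..1}. x \<le> y \<longrightarrow> y - x < \<delta> \<longrightarrow>
     minkowski_qm y - minkowski_qm x \<le> (1 / 2) ^ n"
proof (induction n)
  case 0
  have "minkowski_qm y - minkowski_qm x \<le> 1" if "x \<in> {0..1}" "y \<in> {0..1}" for x y
    using minkowski_qm_bounds[OF that(1)] minkowski_qm_bounds[OF that(2)] by simp
  then show ?case by (intro exI[of _ 1]) auto
next
  case (Suc n)
  then obtain \<delta> where "\<delta> > 0" and \<delta>: "\<And>x y. x \<in> {0..1} \<Longrightarrow> y \<in> {0..1} \<Longrightarrow> x \<le> y \<Longrightarrow> y - x < \<delta> \<Longrightarrow>
     minkowski_qm y - minkowski_qm x \<le> (1 / 2) ^ n" by blast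
  have left: "minkowski_qm y - minkowski_qm x \<le> (1 / 2) ^ n / 2"
    if xy: "0 \<le> x" "x \<le> y" "y \<le> 1 / 2" "y - x < \<delta> / 4" for x y
  proof -
    define u where "u = x / (1 - x)"
    have xh: "0 \<le> x" "x \<le> 1 / 2" using xy by simp_all
    note u = left_half_stretch[OF xh, folded u_def]
    define v where "v = y / (1 - y)"
    have yh: "0 \<le> y" "y \<le> 1 / 2" using xy by simp_all
    note v = left_half_stretch[OF yh, folded v_def]
    have "v - u = (y - x) / ((1 - x) * (1 - y))"
      unfolding u_def v_def using xy by (simp add: field_simps)
    also have "\<dots> \<le> (y - x) / ((1 / 2) * (1 / 2))" using xy
      by (intro divide_left_mono mult_mono) auto
    finally have "v - u < \<delta>" using xy by simp
    moreover have "u \<le> v" unfolding u_def v_def using xy by (intro frac_le) auto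
    ultimately show ?thesis
      using \<delta>[of u v] u(1,2) v(1,2) by simp
  qed
  have right: "minkowski_qm y - minkowski_qm x \<le> (1 / 2) ^ n / 2"
    if xy: "1 / 2 \<le> x" "x \<le> y" "y \<le> 1" "y - x < \<delta> / 4" for x y
    using left[of "1 - y" "1 - x"] xy minkowski_qm_reflect[of x] minkowski_qm_reflect[of y] by simp
  \<comment> \<open>The threshold makes 1 - u at most 1/(n+2), where the function equals
    (1/2)^(n+1). The functional equation halves this once more, to a quarter of (1/2)^n on each side
    of 1/2.\<close>
  have near_half: "1 / 2 - minkowski_qm x \<le> (1 / 2) ^ n / 4"
    if x: "0 \<le> x" "x \<le> 1 / 2" "1 / 2 - x < 1 / (4 * (real n + 2))" for x
  proof -
    define u where "u = x / (1 - x)"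
    have xh: "0 \<le> x" "x \<le> 1 / 2" using x by simp_all
    note u = left_half_stretch[OF xh, folded u_def]
    have "1 - u = (1 - 2 * x) / (1 - x)" unfolding u_def using x by (simp add: field_simps)
    also have "\<dots> \<le> (1 - 2 * x) / (1 / 2)" using x by (intro divide_left_mono) auto
    also have "\<dots> = 4 * (1 / 2 - x)" by simp
    also have "\<dots> \<le> 4 * (1 / (4 * (real n + 2)))" using x(3) by (intro mult_left_mono) auto
    also have "\<dots> = 1 / (real (Suc n) + 1)" by (simp add: field_simps)
    finally have "minkowski_qm (1 - u) \<le> minkowski_qm (1 / (real (Suc n) + 1))"
      using u(1) by (intro minkowski_qm_mono) (auto simp: field_simps)
    also have "\<dots> = (1 / 2) ^ Suc n" using minkowski_qm_branch[of 0 "Suc n"] by simp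
    finally show ?thesis using minkowski_qm_reflect[OF u(1)] u(2) by simp
  qed
  have "minkowski_qm y - minkowski_qm x \<le> (1 / 2) ^ Suc n"
    if xy: "x \<in> {0..1}" "y \<in> {0..1}" "x \<le> y" "y - x < min (\<delta> / 4) (1 / (4 * (real n + 2)))" for x y
  proof -
    consider "y \<le> 1 / 2" | "1 / 2 \<le> x" | "x \<le> 1 / 2" "1 / 2 \<le> y" by linarith
    then show ?thesis
    proof cases
      case 1 then show ?thesis using left[of x y] xy \<open>\<delta> > 0\<close> by simp
    next
      case 2 then show ?thesis using right[of x y] xy \<open>\<delta> > 0\<close> by simp
    next
      case 3
      then show ?thesis
        using near_half[of x] near_half[of "1 - y"] minkowski_qm_reflect[of y] xy by simp
    qed
  qed
  then show ?case using \<open>\<delta> > 0\<close> by (intro exI[of _ "min (\<delta> / 4) (1 / (4 * (real n + 2)))"]) auto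
qed

subsection \<open>The measure of the question mark function\<close>

lemma continuous_on_minkowski_qm: "continuous_on {0..1} minkowski_qm"
  unfolding continuous_on_iff
proof (intro ballI allI impI)
  fix x e :: real
  assume x: "x \<in> {0..1}" and "0 < e"
  obtain n where n: "(1 / 2) ^ n < e" using real_arch_pow_inv[OF \<open>0 < e\<close>, of "1 / 2"] by auto
  obtain \<delta> where "\<delta> > 0" and \<delta>: "\<And>x y. x \<in> {0..1} \<Longrightarrow> y \<in> {0..1} \<Longrightarrow> x \<le> y \<Longrightarrow> y - x < \<delta> \<Longrightarrow>
     minkowski_qm y - minkowski_qm x \<le> (1 / 2) ^ n" using minkowski_qm_uniform[of n] by blast
  have "dist (minkowski_qm y) (minkowski_qm x) < e" if y: "y \<in> {0..1}" "dist y x < \<delta>" for y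
  proof (cases "x \<le> y")
    case True
    then have "minkowski_qm x \<le> minkowski_qm y" using minkowski_qm_mono[of x y] x y by simp
    then show ?thesis using \<delta>[of x y] True x y n by (simp add: dist_real_def)
  next
    case False
    then have "minkowski_qm y \<le> minkowski_qm x" using minkowski_qm_mono[of y x] x y by simp
    then show ?thesis using \<delta>[of y x] False x y n by (simp add: dist_real_def)
  qed
  then show "\<exists>d>0. \<forall>x'\<in>{0..1}. dist x' x < d \<longrightarrow> dist (minkowski_qm x') (minkowski_qm x) < e"
    using \<open>\<delta> > 0\<close> by blast
qed

lemma inj_on_minkowski_qm: "inj_on minkowski_qm {0..1}"
  by (rule linorder_inj_onI') (use minkowski_qm_strict_mono in force)

lemma minkowski_qm_image: "minkowski_qm ` {0..1} = {0..1}"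
proof
  show "{0..1} \<subseteq> minkowski_qm ` {0..1}"
  proof
    fix u :: real assume "u \<in> {0..1}"
    then show "u \<in> minkowski_qm ` {0..1}"
      using IVT'[of minkowski_qm 0 u 1] continuous_on_minkowski_qm by auto
  qed
qed (use minkowski_qm_bounds in auto)

text \<open>Clamping the argument makes the inverse continuous, hence Borel, on the whole line.\<close>

definition qm_inv :: "real \<Rightarrow> real" where
  "qm_inv u = the_inv_into {0..1} minkowski_qm (max 0 (min 1 u))"

lemma qm_inv_minkowski_qm:
  assumes "x \<in> {0..1}"
  shows "qm_inv (minkowski_qm x) = x"
  using minkowski_qm_bounds[OF assms] assms
  by (simp add: qm_inv_def the_inv_into_f_f[OF inj_on_minkowski_qm])

lemma qm_inv_eqI:
  assumes "x \<in> {0..1}" "minkowski_qm x = u"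
  shows "qm_inv u = x"
  using qm_inv_minkowski_qm assms by blast

lemma qm_inv_bounds: "0 \<le> qm_inv u" "qm_inv u \<le> 1"
proof -
  have "max 0 (min 1 u) \<in> minkowski_qm ` {0..1}" unfolding minkowski_qm_image by simp
  from the_inv_into_into[OF inj_on_minkowski_qm this order_refl]
  show "0 \<le> qm_inv u" "qm_inv u \<le> 1" by (simp_all add: qm_inv_def)
qed

lemma minkowski_qm_qm_inv:
  assumes "u \<in> {0..1}"
  shows "minkowski_qm (qm_inv u) = u"
proof -
  have "u \<in> minkowski_qm ` {0..1}" using assms unfolding minkowski_qm_image .
  then show ?thesis using qm_inv_minkowski_qm by auto
qed

lemma continuous_on_qm_inv: "continuous_on S qm_inv"
proof -
  have "continuous_on {0..1} (the_inv_into {0..1} minkowski_qm)"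
    using continuous_on_inv[OF continuous_on_minkowski_qm compact_Icc]
      the_inv_into_f_f[OF inj_on_minkowski_qm] by (simp add: minkowski_qm_image)
  then have "continuous_on S ((the_inv_into {0..1} minkowski_qm) \<circ> (\<lambda>u. max 0 (min 1 u)))"
    by (intro continuous_on_compose continuous_intros) (auto elim: continuous_on_subset)
  then show ?thesis by (simp add: qm_inv_def[abs_def] o_def)
qed

lemma borel_measurable_qm_inv [measurable]: "qm_inv \<in> borel_measurable borel"
  by (rule borel_measurable_continuous_onI) (rule continuous_on_qm_inv)

lemma qm_inv_reflect:
  assumes "u \<in> {0..1}"
  shows "qm_inv (1 - u) = 1 - qm_inv u"
  using qm_inv_bounds[of u] minkowski_qm_reflect[of "qm_inv u"] minkowski_qm_qm_inv[OF assms]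
  by (intro qm_inv_eqI) auto

text \<open>In the variable u = ?(x) the Gauss branches become affine, which makes the change of
  variables in \<open>nn_integral_qm_measure_branches\<close> linear.\<close>

lemma qm_inv_branch:
  assumes "u \<in> {0..1}"
  shows "qm_inv ((1 / 2) ^ n - (1 / 2) ^ Suc n * u) = 1 / (real n + 1 + qm_inv u)"
  using qm_inv_bounds[of u] minkowski_qm_branch[of "qm_inv u" n] minkowski_qm_qm_inv[OF assms]
  by (intro qm_inv_eqI) (auto simp: divide_le_eq)

text \<open>Substitution u = ?(x): an interval [a,b] with tag x corresponds to [?(a), ?(b)], of
  length equal to its weight in the sum. There \<open>f (qm_inv u)\<close> is uniformly close to
  \<open>f x\<close>, and the weights add up to 1.\<close>

lemma has_rs_integral_minkowski_qm:
  assumes f: "continuous_on {0..1} f"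
  shows "has_rs_integral f minkowski_qm 0 1 (integral {0..1} (\<lambda>u. f (qm_inv u)))"
  unfolding has_rs_integral_def
proof (intro allI impI)
  fix e :: real assume e: "0 < e"
  define h where "h u = f (qm_inv u)" for u
  define H where "H u = integral {0..u} h" for u
  have h: "continuous_on S h" for S
    unfolding h_def
    by (rule continuous_on_compose2[OF f continuous_on_qm_inv]) (use qm_inv_bounds in auto)
  have H_diff: "H d - H c = integral {c..d} h" if "0 \<le> c" "c \<le> d" for c d
    using Henstock_Kurzweil_Integration.integral_combine[OF that, of h] h
    by (simp add: H_def integrable_continuous_interval)
  have "uniformly_continuous_on {0..1} f" by (rule compact_uniformly_continuous[OF f compact_Icc])
  \<comment> \<open>The termwise estimates are not strict, so half of \<open>e\<close> is used to
    end strictly below \<open>e\<close>.\<close>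
  then obtain \<delta> where "\<delta> > 0" and
    \<delta>: "\<And>x y. x \<in> {0..1} \<Longrightarrow> y \<in> {0..1} \<Longrightarrow> dist y x < \<delta> \<Longrightarrow> dist (f y) (f x) < e / 2"
    unfolding uniformly_continuous_on_def using e by (metis half_gt_zero)
  have "\<bar>(\<Sum>(x, K)\<in>p. f x * (minkowski_qm (Sup K) - minkowski_qm (Inf K))) - integral {0..1} h\<bar> < e"
    if p: "p tagged_division_of {0..1}" "(\<lambda>x. ball x \<delta>) fine p" for p
  proof -
    let ?g = "\<lambda>K. minkowski_qm (Sup K) - minkowski_qm (Inf K)"
    \<comment> \<open>The values of \<open>H\<close> at the transformed endpoints telescope to the
      full integral, so the error can be estimated one tagged interval at a time.\<close>
    let ?G = "\<lambda>K. H (minkowski_qm (Sup K)) - H (minkowski_qm (Inf K))"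
    have G: "(\<Sum>(x, K)\<in>p. ?G K) = integral {0..1} h"
      using additive_tagged_division_1[OF zero_le_one p(1), of "\<lambda>x. H (minkowski_qm x)"]
      by (simp add: H_def)
    have g: "(\<Sum>(x, K)\<in>p. ?g K) = 1"
      using additive_tagged_division_1[OF zero_le_one p(1), of minkowski_qm] by simp
    have pt: "\<bar>f x * ?g K - ?G K\<bar> \<le> e / 2 * ?g K" if xK: "(x, K) \<in> p" for x K
    proof -
      obtain a b where K: "K = {a..b}" using tagged_division_ofD(4)[OF p(1) xK] by auto
      have "x \<in> K" "K \<subseteq> {0..1}" using tagged_division_ofD(2,3)[OF p(1) xK] .
      then have ab: "a \<le> b" "0 \<le> a" "b \<le> 1" "x \<in> {0..1}" using K by auto
      have ball: "K \<subseteq> ball x \<delta>" using p(2) xK by (auto simp: fine_def)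
      let ?c = "minkowski_qm a" and ?d = "minkowski_qm b"
      have cd: "0 \<le> ?c" "?c \<le> ?d" "?d \<le> 1"
        using minkowski_qm_bounds[of a] minkowski_qm_bounds[of b] minkowski_qm_mono[of a b] ab by auto
      have "norm (integral {?c..?d} (\<lambda>s. f x - h s)) \<le> e / 2 * (?d - ?c)"
      proof (rule integral_bound[OF cd(2)])
        show "continuous_on {?c..?d} (\<lambda>s. f x - h s)" by (intro continuous_intros h)
        fix s assume s: "s \<in> {?c..?d}"
        then have s': "minkowski_qm (qm_inv s) = s" using cd by (intro minkowski_qm_qm_inv) auto
        have "a \<le> qm_inv s"
          using minkowski_qm_strict_mono[of "qm_inv s" a] s s' ab qm_inv_bounds[of s] by force
        moreover have "qm_inv s \<le> b"
          using minkowski_qm_strict_mono[of b "qm_inv s"] s s' ab qm_inv_bounds[of s] by force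
        ultimately have "qm_inv s \<in> ball x \<delta>" using ball K by auto
        then show "norm (f x - h s) \<le> e / 2"
          using \<delta>[of "qm_inv s" x] ab(4) qm_inv_bounds[of s] by (simp add: h_def dist_real_def)
      qed
      moreover have "integral {?c..?d} (\<lambda>s. f x - h s) = f x * (?d - ?c) - integral {?c..?d} h"
        using cd by (subst integral_diff) (auto intro!: integrable_continuous_interval h)
      ultimately show ?thesis using H_diff[OF cd(1,2)] ab K by simp
    qed
    have "(\<Sum>(x, K)\<in>p. f x * ?g K) - integral {0..1} h = (\<Sum>(x, K)\<in>p. f x * ?g K - ?G K)"
      unfolding G[symmetric] by (simp add: sum_subtractf split_def)
    also have "\<bar>\<dots>\<bar> \<le> (\<Sum>(x, K)\<in>p. \<bar>f x * ?g K - ?G K\<bar>)"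
      using sum_abs[of "\<lambda>(x, K). f x * ?g K - ?G K" p] by (simp add: split_def)
    also have "\<dots> \<le> (\<Sum>(x, K)\<in>p. e / 2 * ?g K)" using pt by (intro sum_mono) auto
    also have "\<dots> = e / 2 * (\<Sum>(x, K)\<in>p. ?g K)" by (simp only: sum_distrib_left split_def)
    also have "\<dots> = e / 2" using g by simp
    also have "\<dots> < e" using e by simp
    finally show ?thesis .
  qed
  then show "\<exists>\<delta>>0. \<forall>p. p tagged_division_of {0..1} \<and> (\<lambda>x. ball x \<delta>) fine p \<longrightarrow>
      \<bar>(\<Sum>(x, K)\<in>p. f x * (minkowski_qm (Sup K) - minkowski_qm (Inf K))) -
        integral {0..1} (\<lambda>u. f (qm_inv u))\<bar> < e"
    using \<open>\<delta> > 0\<close> unfolding h_def by blast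
qed

section \<open>The law with distribution function \<open>minkowski_qm\<close>: symmetry and
  self-similarity\<close>

definition qm_measure :: "real measure" where
  "qm_measure = distr (uniform_measure lborel {0..1}) borel qm_inv"

lemma sets_qm_measure [simp, measurable_cong]: "sets qm_measure = sets borel"
  by (simp add: qm_measure_def)

lemma prob_space_qm_measure: "prob_space qm_measure"
proof -
  interpret prob_space "uniform_measure lborel {0..1::real}"
    by (rule prob_space_uniform_measure) auto
  show ?thesis unfolding qm_measure_def by (rule prob_space_distr) simp
qed

lemma nn_integral_qm_measure:
  assumes [measurable]: "f \<in> borel_measurable borel"
  shows "(\<integral>\<^sup>+x. f x \<partial>qm_measure) = (\<integral>\<^sup>+u. f (qm_inv u) * indicator {0..1} u \<partial>lborel)"
  unfolding qm_measure_def by (simp add: nn_integral_distr nn_integral_uniform_measure divide_ennreal_def)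

lemma AE_qm_measure: "AE x in qm_measure. 0 \<le> x \<and> x \<le> 1"
  unfolding qm_measure_def by (subst AE_distr_iff) (auto simp: qm_inv_bounds)

lemma nn_integral_qm_measure_eq_integral:
  assumes f: "continuous_on {0..1} f" "\<And>x. x \<in> {0..1} \<Longrightarrow> 0 \<le> f x" "f \<in> borel_measurable borel"
  shows "(\<integral>\<^sup>+x. ennreal (f x) \<partial>qm_measure) = ennreal (integral {0..1} (\<lambda>u. f (qm_inv u)))"
proof -
  have "continuous_on {0..1} (\<lambda>u. f (qm_inv u))"
    by (rule continuous_on_compose2[OF f(1) continuous_on_qm_inv]) (use qm_inv_bounds in auto)
  then have "((\<lambda>u. f (qm_inv u)) has_integral integral {0..1} (\<lambda>u. f (qm_inv u))) {0..1}"
    by (intro integrable_integral integrable_continuous_interval)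
  from nn_integral_has_integral_lebesgue[OF _ this] show ?thesis
    using f(2,3) qm_inv_bounds
    by (simp add: nn_integral_qm_measure ennreal_mult'' ennreal_indicator mult.commute)
qed

text \<open>The substitution u to 1 - u preserves Lebesgue measure on [0,1] and corresponds under
  \<open>qm_inv\<close> to x to 1 - x.\<close>

lemma nn_integral_qm_measure_reflect:
  assumes [measurable]: "f \<in> borel_measurable borel"
  shows "(\<integral>\<^sup>+x. f (1 - x) \<partial>qm_measure) = (\<integral>\<^sup>+x. f x \<partial>qm_measure)"
proof -
  have "(\<integral>\<^sup>+x. f x \<partial>qm_measure) = (\<integral>\<^sup>+u. f (qm_inv (1 - u)) * indicator {0..1} (1 - u) \<partial>lborel)"
    using nn_integral_real_affine[of "\<lambda>u. f (qm_inv u) * indicator {0..1} u" "-1" 1]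
    by (simp add: nn_integral_qm_measure)
  also have "\<dots> = (\<integral>\<^sup>+u. f (1 - qm_inv u) * indicator {0..1} u \<partial>lborel)"
    by (intro nn_integral_cong) (auto simp: qm_inv_reflect split: split_indicator)
  finally show ?thesis by (simp add: nn_integral_qm_measure)
qed

text \<open>In the variable u, first digit n + 1 occupies ((1/2)^(n+1), (1/2)^n] up to endpoints.
  Each such interval is an affine image of [0,1), and its length is the geometric weight of the
  digit.\<close>

lemma nn_integral_qm_measure_branches:
  assumes f [measurable]: "f \<in> borel_measurable borel"
  shows "(\<integral>\<^sup>+x. f x \<partial>qm_measure) =
    (\<Sum>n. ennreal ((1 / 2) ^ Suc n) * (\<integral>\<^sup>+x. f (1 / (real n + 1 + x)) \<partial>qm_measure))"
proof -
  define B where "B n = {(1 / 2) ^ Suc n<..(1 / 2) ^ n :: real}" for n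
  let ?F = "\<lambda>u. f (qm_inv u)"
  have disj: "disjoint_family B"
  proof -
    have "B m \<inter> B n = {}" if "m < n" for m n
    proof -
      have "(1 / 2 :: real) ^ n \<le> (1 / 2) ^ Suc m" using that by (intro power_decreasing) auto
      then show ?thesis unfolding B_def by auto
    qed
    then show ?thesis unfolding disjoint_family_on_def by (metis Int_commute linorder_neqE_nat)
  qed
  have UN: "(\<Union>n. B n) = {0<..1}"
  proof
    have "B n \<subseteq> {0<..1}" for n
    proof -
      have "(1 / 2 :: real) ^ n \<le> 1" "(0 :: real) < (1 / 2) ^ Suc n" by (simp_all add: power_le_one)
      then show ?thesis unfolding B_def by force
    qed
    then show "(\<Union>n. B n) \<subseteq> {0<..1}" by blast
    show "{0<..1} \<subseteq> (\<Union>n. B n)"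
    proof
      fix u :: real assume u: "u \<in> {0<..1}"
      then have ex: "\<exists>n. (1 / 2) ^ n < u" using real_arch_pow_inv[of u "1 / 2"] by auto
      define N where "N = (LEAST n. (1 / 2) ^ n < u)"
      have N: "(1 / 2) ^ N < u" unfolding N_def by (rule LeastI_ex[OF ex])
      moreover have "N \<noteq> 0" using N u by (cases N) auto
      \<comment> \<open>By minimality of \<open>N\<close>, u lies above (1/2)^N but not above
        (1/2)^(N-1), hence in block N - 1.\<close>
      then obtain m where m: "N = Suc m" using not0_implies_Suc by blast
      have "\<not> (1 / 2) ^ m < u" using not_less_Least[of m "\<lambda>n. (1 / 2) ^ n < u"] m
        unfolding N_def by simp
      ultimately show "u \<in> (\<Union>n. B n)" using m unfolding B_def by auto
    qed
  qed
  have piece: "(\<integral>\<^sup>+u. ?F u * indicator (B n) u \<partial>lborel) =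
      ennreal ((1 / 2) ^ Suc n) * (\<integral>\<^sup>+x. f (1 / (real n + 1 + x)) \<partial>qm_measure)" for n
  proof -
    let ?c = "(1 / 2) ^ Suc n :: real"
    have t: "(1 / 2 :: real) ^ n = 2 * ?c" and c: "?c > 0" by simp_all
    \<comment> \<open>The slope is negative, so the block that is closed on the right pulls back to
      [0,1), closed on the left. The missing point u = 1 is null.\<close>
    have ind: "indicator (B n) ((1 / 2) ^ n + - ?c * u) = (indicator {0..<1} u :: ennreal)" for u
    proof -
      have "?c * u < ?c \<longleftrightarrow> u < 1" "0 \<le> ?c * u \<longleftrightarrow> 0 \<le> u"
        using mult_less_cancel_left_pos[OF c, of u 1] mult_le_cancel_left_pos[OF c, of 0 u] by simp_all
      then have "(1 / 2) ^ n + - ?c * u \<in> B n \<longleftrightarrow> u \<in> {0..<1}"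
        unfolding B_def t greaterThanAtMost_iff atLeastLessThan_iff by linarith
      then show ?thesis by (simp only: indicator_def)
    qed
    have "(\<integral>\<^sup>+u. ?F u * indicator (B n) u \<partial>lborel) =
        ennreal ?c * (\<integral>\<^sup>+u. ?F ((1 / 2) ^ n + - ?c * u) * indicator (B n) ((1 / 2) ^ n + - ?c * u) \<partial>lborel)"
    proof (subst nn_integral_real_affine[of _ "- ?c" "(1 / 2) ^ n"])
      show "(\<lambda>u. ?F u * indicator (B n) u) \<in> borel_measurable borel" unfolding B_def by measurable
      show "- ?c \<noteq> 0" using c by linarith
    qed (use c in simp)
    also have "(\<integral>\<^sup>+u. ?F ((1 / 2) ^ n + - ?c * u) * indicator (B n) ((1 / 2) ^ n + - ?c * u) \<partial>lborel) =
        (\<integral>\<^sup>+u. f (1 / (real n + 1 + qm_inv u)) * indicator {0..1} u \<partial>lborel)"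
      unfolding ind
    proof (intro nn_integral_cong_AE)
      show "AE u in lborel. ?F ((1 / 2) ^ n + - ?c * u) * indicator {0..<1} u =
          f (1 / (real n + 1 + qm_inv u)) * indicator {0..1} u"
        using AE_lborel_singleton[of "1::real"]
      proof eventually_elim
        case (elim u)
        show ?case
        proof (cases "u \<in> {0..<1}")
          case True
          then have "u \<in> {0..1}" by simp
          from qm_inv_branch[OF this, of n] show ?thesis using True by simp
        qed (use elim in \<open>auto simp: indicator_def\<close>)
      qed
    qed
    finally show ?thesis by (simp add: nn_integral_qm_measure)
  qed
  have "(\<integral>\<^sup>+x. f x \<partial>qm_measure) = (\<integral>\<^sup>+u. ?F u * indicator {0..1} u \<partial>lborel)"
    by (rule nn_integral_qm_measure[OF f])
  also have "\<dots> = (\<integral>\<^sup>+u. ?F u * indicator {0<..1} u \<partial>lborel)"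
  proof (intro nn_integral_cong_AE)
    show "AE u in lborel. ?F u * indicator {0..1} u = ?F u * indicator {0<..1} u"
      using AE_lborel_singleton[of "0::real"]
      by eventually_elim (auto simp: indicator_def)
  qed
  also have "\<dots> = (\<Sum>n. \<integral>\<^sup>+u. ?F u * indicator (B n) u \<partial>lborel)"
    unfolding UN[symmetric]
    by (rule nn_integral_disjoint_family[OF _ _ disj]) (auto simp: B_def)
  finally show ?thesis unfolding piece .
qed

subsection \<open>The Bessel kernel\<close>

text \<open>\<open>I\<^sub>1(2\<surd>z) / \<surd>z\<close> as an entire function of \<open>z\<close>.\<close>

definition bessel_core :: "real \<Rightarrow> real" where
  "bessel_core z = (\<Sum>k. z ^ k / (fact k * fact (k + 1)))"

lemma summable_bessel_core: "summable (\<lambda>k. z ^ k / (fact k * fact (k + 1)) :: real)"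
proof (rule summable_comparison_test)
  show "summable (\<lambda>k. inverse (fact k) * \<bar>z\<bar> ^ k)" by (rule summable_exp)
  have "norm (z ^ k / (fact k * fact (k + 1))) \<le> inverse (fact k) * \<bar>z\<bar> ^ k" for k
  proof -
    have "norm (z ^ k / (fact k * fact (k + 1))) = \<bar>z\<bar> ^ k / fact k / fact (k + 1)"
      by (simp add: abs_mult power_abs del: fact_Suc)
    also have "\<dots> \<le> \<bar>z\<bar> ^ k / fact k"
      using divide_left_mono[of 1 "fact (k + 1)" "\<bar>z\<bar> ^ k / fact k"] fact_ge_1[of "k + 1"]
      by (simp del: fact_Suc)
    finally show ?thesis by (simp add: field_simps)
  qed
  then show "\<exists>N. \<forall>n\<ge>N. norm (z ^ n / (fact n * fact (n + 1))) \<le> inverse (fact n) * \<bar>z\<bar> ^ n"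
    by blast
qed

lemma bessel_core_nonneg: "0 \<le> z \<Longrightarrow> 0 \<le> bessel_core z"
  unfolding bessel_core_def by (intro suminf_nonneg summable_bessel_core) simp

lemma borel_measurable_bessel_core [measurable]: "bessel_core \<in> borel_measurable borel"
  unfolding bessel_core_def[abs_def] by measurable

lemma borel_measurable_bessel_I1 [measurable]: "bessel_I1 \<in> borel_measurable borel"
  unfolding bessel_I1_def[abs_def] by measurable

lemma bessel_I1_sqrt:
  assumes "0 \<le> z"
  shows "bessel_I1 (2 * sqrt z) = sqrt z * bessel_core z"
proof -
  have "(2 * sqrt z / 2) ^ (2 * k + 1) = sqrt z * z ^ k" for k
    using assms by (simp add: power_mult)
  then have "bessel_I1 (2 * sqrt z) = (\<Sum>k. sqrt z * (z ^ k / (fact k * fact (k + 1))))"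
    unfolding bessel_I1_def by (simp only: times_divide_eq_right)
  then show ?thesis unfolding bessel_core_def by (simp only: suminf_mult[OF summable_bessel_core])
qed

text \<open>The Gamma integral, obtained from the total mass (zeroth moment) of an Erlang
  density.\<close>

lemma nn_integral_power_exp:
  assumes "0 < p"
  shows "(\<integral>\<^sup>+s. ennreal (s ^ k * exp (- (p * s))) * indicator {0<..} s \<partial>lborel) =
    ennreal (fact k / p ^ Suc k)"
proof -
  have "(\<integral>\<^sup>+s. ennreal (s ^ k * exp (- (p * s))) * indicator {0<..} s \<partial>lborel) =
      (\<integral>\<^sup>+s. ennreal (fact k / p ^ Suc k) * ennreal (erlang_density k p s * s ^ 0) \<partial>lborel)"
  proof (intro nn_integral_cong_AE)
    show "AE s in lborel. ennreal (s ^ k * exp (- (p * s))) * indicator {0<..} s =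
        ennreal (fact k / p ^ Suc k) * ennreal (erlang_density k p s * s ^ 0)"
      using AE_lborel_singleton[of "0::real"]
      by eventually_elim
         (use assms in \<open>auto simp: erlang_density_def indicator_def ennreal_mult[symmetric]\<close>)
  qed
  also have "\<dots> = ennreal (fact k / p ^ Suc k)"
    using nn_integral_erlang_ith_moment[OF assms, of k 0] by (simp add: nn_integral_cmult)
  finally show ?thesis .
qed

text \<open>Integrated term by term, the k-th summand becomes (t/p)^(k+1)/(k+1)!: the exponential
  series without its constant term.\<close>

lemma nn_integral_bessel_exp:
  assumes "0 < p" "0 \<le> t"
  shows "(\<integral>\<^sup>+s. ennreal (t * bessel_core (t * s) * exp (- (p * s))) * indicator {0<..} s \<partial>lborel) =
    ennreal (exp (t / p) - 1)"
proof -
  define c where "c k = t ^ Suc k / (fact k * fact (k + 1))" for k :: nat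
  have c: "0 \<le> c k" for k using assms by (simp add: c_def)
  have "(\<integral>\<^sup>+s. ennreal (t * bessel_core (t * s) * exp (- (p * s))) * indicator {0<..} s \<partial>lborel) =
      (\<integral>\<^sup>+s. (\<Sum>k. ennreal (c k) * (ennreal (s ^ k * exp (- (p * s))) * indicator {0<..} s)) \<partial>lborel)"
  proof (intro nn_integral_cong)
    fix s :: real
    show "ennreal (t * bessel_core (t * s) * exp (- (p * s))) * indicator {0<..} s =
        (\<Sum>k. ennreal (c k) * (ennreal (s ^ k * exp (- (p * s))) * indicator {0<..} s))"
    proof (cases "0 < s")
      case True
      have "c k * (s ^ k * exp (- (p * s))) =
          t * exp (- (p * s)) * ((t * s) ^ k / (fact k * fact (k + 1)))" for k
        by (simp add: c_def power_mult_distrib)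
      then have "(\<lambda>k. c k * (s ^ k * exp (- (p * s)))) sums
          (t * exp (- (p * s)) * bessel_core (t * s))"
        unfolding bessel_core_def
        by (simp only:) (rule sums_mult[OF summable_sums[OF summable_bessel_core]])
      then have "(\<lambda>k. ennreal (c k * (s ^ k * exp (- (p * s))))) sums
          ennreal (t * exp (- (p * s)) * bessel_core (t * s))"
        using True c assms bessel_core_nonneg[of "t * s"] by (subst sums_ennreal) auto
      then show ?thesis using True c
        by (simp add: sums_iff ennreal_mult' mult_ac)
    qed simp
  qed
  also have "\<dots> = (\<Sum>k. ennreal (c k) * ennreal (fact k / p ^ Suc k))"
    by (subst nn_integral_suminf) (simp_all add: nn_integral_cmult nn_integral_power_exp[OF assms(1)])
  also have "\<dots> = (\<Sum>k. ennreal ((t / p) ^ Suc k / fact (Suc k)))"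
    using c assms by (intro suminf_cong)
      (simp add: ennreal_mult[symmetric] c_def power_divide del: power_Suc fact_Suc)
  also have "\<dots> = ennreal (exp (t / p) - 1)"
  proof -
    have "(\<lambda>k. (t / p) ^ Suc k / fact (Suc k)) sums (exp (t / p) - 1)"
      using exp_converges[of "t / p"]
      by (subst sums_Suc_iff) (simp add: divide_inverse mult.commute)
    then have "(\<lambda>k. ennreal ((t / p) ^ Suc k / fact (Suc k))) sums ennreal (exp (t / p) - 1)"
      using assms by (subst sums_ennreal) auto
    then show ?thesis by (simp only: sums_iff)
  qed
  finally show ?thesis .
qed

text \<open>This is exp(-s) E(exp(-a s)) for a geometric digit a with P(a = n+1) = (1/2)^(n+1). The
  extra exp(-s) comes from replacing x by 1 - x in the branch 1/(a+x).\<close>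

definition qm_weight :: "real \<Rightarrow> real" where
  "qm_weight s = 1 / (exp s * (2 * exp s - 1))"

lemma qm_weight_nonneg: "0 \<le> s \<Longrightarrow> 0 \<le> qm_weight s"
  unfolding qm_weight_def using one_le_exp_iff[of s]
  by (intro divide_nonneg_nonneg mult_nonneg_nonneg) linarith+

lemma borel_measurable_qm_weight [measurable]: "qm_weight \<in> borel_measurable borel"
  unfolding qm_weight_def[abs_def] by measurable

lemma qm_weight_sums:
  assumes "0 \<le> s"
  shows "(\<lambda>n. (1 / 2) ^ Suc n * exp (- ((real n + 2) * s))) sums qm_weight s"
proof -
  define q where "q = exp (- s) / 2"
  have "exp (- s) \<le> 1" using assms by simp
  then have q: "0 < q" "q < 1" unfolding q_def using exp_gt_zero[of "- s"] by linarith+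
  have "(\<lambda>n. exp (- s) * q * q ^ n) sums (exp (- s) * q * (1 / (1 - q)))"
    by (rule sums_mult[OF geometric_sums]) (use q in simp)
  moreover have "exp (- s) * q * (1 / (1 - q)) = qm_weight s"
  proof -
    have "q * (2 * exp s) = 1" by (simp add: q_def exp_minus)
    then have "q * (2 * exp s - 1) = 1 - q" by (simp only: right_diff_distrib mult_1_right)
    moreover have "1 \<le> exp s" using assms by simp
    then have "2 * exp s - 1 \<noteq> 0" by linarith
    ultimately have "q * (1 / (1 - q)) = 1 / (2 * exp s - 1)" using q by (simp add: divide_simps)
    then show ?thesis unfolding mult.assoc by (simp add: qm_weight_def exp_minus divide_inverse)
  qed
  moreover have "exp (- s) * q * q ^ n = (1 / 2) ^ Suc n * exp (- ((real n + 2) * s))" for n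
  proof -
    have "q ^ Suc n = (1 / 2) ^ Suc n * exp (- s) ^ Suc n"
      unfolding q_def by (simp only: power_mult_distrib[symmetric]) simp
    then have "exp (- s) * q * q ^ n = (1 / 2) ^ Suc n * (exp (- s) * exp (- s) ^ Suc n)"
      by (simp del: power_Suc add: mult.assoc power_Suc[symmetric, of q])
    also have "exp (- s) * exp (- s) ^ Suc n = exp (- ((real n + 2) * s))"
      by (simp add: exp_of_nat_mult[symmetric] exp_add[symmetric] algebra_simps del: power_Suc)
    finally show ?thesis .
  qed
  ultimately show ?thesis by simp
qed

text \<open>Expanding the weight geometrically and absorbing exp(x s) leaves Laplace transforms of
  \<open>g\<close> at the points n + 2 - x.\<close>

lemma nn_integral_qm_weight_exp:
  assumes g: "\<And>s. 0 < s \<Longrightarrow> 0 \<le> g s" and [measurable]: "g \<in> borel_measurable borel"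
  shows "(\<integral>\<^sup>+s. ennreal (g s * qm_weight s) * indicator {0<..} s * ennreal (exp (x * s)) \<partial>lborel) =
    (\<Sum>n. ennreal ((1 / 2) ^ Suc n) *
      (\<integral>\<^sup>+s. ennreal (g s * exp (- ((real n + 2 - x) * s))) * indicator {0<..} s \<partial>lborel))"
proof -
  have "(\<integral>\<^sup>+s. ennreal (g s * qm_weight s) * indicator {0<..} s * ennreal (exp (x * s)) \<partial>lborel) =
    (\<integral>\<^sup>+s. (\<Sum>n. ennreal ((1 / 2) ^ Suc n) *
       (ennreal (g s * exp (- ((real n + 2 - x) * s))) * indicator {0<..} s)) \<partial>lborel)"
  proof (intro nn_integral_cong)
    fix s :: real
    show "ennreal (g s * qm_weight s) * indicator {0<..} s * ennreal (exp (x * s)) =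
      (\<Sum>n. ennreal ((1 / 2) ^ Suc n) *
        (ennreal (g s * exp (- ((real n + 2 - x) * s))) * indicator {0<..} s))"
    proof (cases "0 < s")
      case True
      have e: "(1 / 2) ^ Suc n * (g s * exp (- ((real n + 2 - x) * s))) =
          g s * exp (x * s) * ((1 / 2) ^ Suc n * exp (- ((real n + 2) * s)))" for n
      proof -
        have "exp (- ((real n + 2 - x) * s)) = exp (x * s) * exp (- ((real n + 2) * s))"
          by (simp add: exp_add[symmetric] algebra_simps)
        then show ?thesis by simp
      qed
      have "(\<lambda>n. (1 / 2) ^ Suc n * (g s * exp (- ((real n + 2 - x) * s)))) sums
          (g s * exp (x * s) * qm_weight s)"
        unfolding e by (rule sums_mult[OF qm_weight_sums]) (use True in simp)
      then have "(\<lambda>n. ennreal ((1 / 2) ^ Suc n * (g s * exp (- ((real n + 2 - x) * s))))) sums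
          ennreal (g s * exp (x * s) * qm_weight s)"
        using True g[OF True] qm_weight_nonneg[of s] by (subst sums_ennreal) auto
      then have "(\<Sum>n. ennreal ((1 / 2) ^ Suc n) * ennreal (g s * exp (- ((real n + 2 - x) * s)))) =
          ennreal (g s * exp (x * s) * qm_weight s)"
        by (simp only: sums_iff) (simp add: ennreal_mult' del: power_Suc)
      moreover have "ennreal (g s * qm_weight s) * ennreal (exp (x * s)) =
          ennreal (g s * exp (x * s) * qm_weight s)"
        using g[OF True] qm_weight_nonneg[of s] True by (simp add: ennreal_mult[symmetric] mult_ac)
      ultimately show ?thesis using True by simp
    qed simp
  qed
  also have "\<dots> = (\<Sum>n. ennreal ((1 / 2) ^ Suc n) *
      (\<integral>\<^sup>+s. ennreal (g s * exp (- ((real n + 2 - x) * s))) * indicator {0<..} s \<partial>lborel))"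
    by (subst nn_integral_suminf) (simp_all add: nn_integral_cmult del: power_Suc)
  finally show ?thesis .
qed

text \<open>For positive t and s the factor \<open>t * bessel_core (t * s)\<close> is sqrt(t/s)
  I_1(2 sqrt(ts)), written without a singularity at 0. The indicator confines all later comparisons
  of functions to s > 0.\<close>

definition qm_kernel :: "real \<Rightarrow> real \<Rightarrow> ennreal" where
  "qm_kernel t s = ennreal (t * bessel_core (t * s) * qm_weight s) * indicator {0<..} s"

lemma borel_measurable_qm_kernel [measurable]:
  "case_prod qm_kernel \<in> borel_measurable (borel \<Otimes>\<^sub>M borel)"
  unfolding qm_kernel_def[abs_def] by measurable

definition qm_op :: "(real \<Rightarrow> ennreal) \<Rightarrow> real \<Rightarrow> ennreal" where
  "qm_op \<phi> t = (\<integral>\<^sup>+s. qm_kernel t s * \<phi> s \<partial>lborel)"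

lemma borel_measurable_qm_op [measurable]:
  assumes [measurable]: "\<phi> \<in> borel_measurable borel"
  shows "qm_op \<phi> \<in> borel_measurable borel"
  unfolding qm_op_def[abs_def] by measurable

lemma borel_measurable_qm_op_pow [measurable]:
  assumes "\<phi> \<in> borel_measurable borel"
  shows "(qm_op ^^ n) \<phi> \<in> borel_measurable borel"
  by (induction n) (simp_all add: assms borel_measurable_qm_op)

lemma qm_op_mono:
  assumes "\<And>s. 0 < s \<Longrightarrow> \<phi> s \<le> \<psi> s"
  shows "qm_op \<phi> t \<le> qm_op \<psi> t"
  unfolding qm_op_def
  by (intro nn_integral_mono) (use assms in \<open>auto simp: qm_kernel_def indicator_def intro!: mult_left_mono\<close>)

lemma qm_op_cong:
  assumes "\<And>s. 0 < s \<Longrightarrow> \<phi> s = \<psi> s"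
  shows "qm_op \<phi> t = qm_op \<psi> t"
  by (intro antisym qm_op_mono) (simp_all add: assms)

lemma qm_op_add:
  assumes [measurable]: "\<phi> \<in> borel_measurable borel" "\<psi> \<in> borel_measurable borel"
  shows "qm_op (\<lambda>s. \<phi> s + \<psi> s) t = qm_op \<phi> t + qm_op \<psi> t"
  unfolding qm_op_def by (simp add: distrib_left nn_integral_add)

lemma qm_op_cmult:
  assumes [measurable]: "\<phi> \<in> borel_measurable borel"
  shows "qm_op (\<lambda>s. c * \<phi> s) t = c * qm_op \<phi> t"
  unfolding qm_op_def by (subst nn_integral_cmult[symmetric]) (simp_all add: mult_ac)

lemma qm_op_exp:
  assumes "0 \<le> t" "x \<le> 1"
  shows "qm_op (\<lambda>s. ennreal (exp (x * s))) t =
    (\<Sum>n. ennreal ((1 / 2) ^ Suc n) * ennreal (exp (t / (real n + 2 - x)) - 1))"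
  unfolding qm_op_def qm_kernel_def using assms
  by (subst nn_integral_qm_weight_exp)
     (simp_all add: bessel_core_nonneg nn_integral_bessel_exp del: power_Suc)

lemma qm_op_exp_1:
  assumes "0 \<le> t"
  shows "qm_op (\<lambda>s. ennreal (exp s)) t =
    (\<Sum>n. ennreal ((1 / 2) ^ Suc n) * ennreal (exp (t / (real n + 1)) - 1))"
proof -
  have "real n + 2 - 1 = real n + 1" for n by simp
  then show ?thesis using qm_op_exp[OF assms, of 1] by (simp only: mult_1 order_refl)
qed

section \<open>Geometric decay of the powers of \<open>qm_op\<close>\<close>

lemma suminf_ennreal_half: "(\<Sum>n. ennreal ((1 / 2) ^ Suc n)) = 1"
proof -
  have "(\<lambda>n. ennreal ((1 / 2) ^ Suc n)) sums ennreal 1"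
    using power_half_series by (subst sums_ennreal) auto
  then show ?thesis by (simp only: sums_iff ennreal_1)
qed

lemma suminf_half_le:
  assumes "\<And>n. g n \<le> c"
  shows "(\<Sum>n. ennreal ((1 / 2) ^ Suc n) * g n) \<le> c"
proof -
  have "(\<Sum>n. ennreal ((1 / 2) ^ Suc n) * g n) \<le> (\<Sum>n. ennreal ((1 / 2) ^ Suc n) * c)"
    by (intro suminf_le summableI mult_left_mono assms) simp
  also have "\<dots> = c" unfolding ennreal_suminf_multc suminf_ennreal_half by simp
  finally show ?thesis .
qed

lemma exp_divide_le:
  fixes t c :: real
  assumes "0 \<le> t" "1 \<le> c"
  shows "ennreal (exp (t / c) - 1) \<le> ennreal (exp t - 1)"
  using divide_left_mono[of 1 c t] assms by (intro ennreal_leI) simp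

lemma qm_op_exp_le:
  assumes "0 \<le> t"
  shows "qm_op (\<lambda>s. ennreal (exp s)) t \<le> ennreal (exp t - 1)"
  unfolding qm_op_exp_1[OF assms] using assms by (intro suminf_half_le exp_divide_le) auto

text \<open>With \<open>h(s) = e\<^sup>s - 1\<close>, the series of the operator
  at \<open>e\<^sup>s\<close> and at \<open>1\<close> are shifts of each other, which gives \<open>K h + K 1 = (h + K 1) / 2\<close>.\<close>

lemma qm_op_expm1_le:
  assumes "0 \<le> t"
  shows "qm_op (\<lambda>s. ennreal (exp s - 1)) t \<le> ennreal (1 / 2) * ennreal (exp t - 1)"
proof -
  let ?h = "qm_op (\<lambda>s. ennreal (exp s - 1)) t" and ?e = "qm_op (\<lambda>s. ennreal (exp s)) t"
    and ?one = "qm_op (\<lambda>s. 1) t"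
  have "?e = qm_op (\<lambda>s. ennreal (exp s - 1) + 1) t"
    by (intro qm_op_cong) (simp add: ennreal_plus[symmetric] flip: ennreal_1 del: ennreal_plus)
  then have split: "?e = ?h + ?one" by (simp add: qm_op_add)
  have one: "?one = (\<Sum>n. ennreal ((1 / 2) ^ Suc n) * ennreal (exp (t / (real n + 2)) - 1))"
    using qm_op_exp[OF assms, of 0] by simp
  have "?one \<le> ennreal (exp t - 1)"
    unfolding one using assms by (intro suminf_half_le exp_divide_le) auto
  \<comment> \<open>Finiteness permits the cancellation of \<open>?one\<close> in the extended reals
    at the end.\<close>
  then have fin: "?one \<noteq> top" by (metis ennreal_less_top not_le top.extremum_strict)
  have "?e = (\<Sum>n. ennreal ((1 / 2) ^ Suc n) * ennreal (exp (t / (real n + 1)) - 1))"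
    by (rule qm_op_exp_1[OF assms])
  \<comment> \<open>The term n = 0 is split off: it is the main term (exp t - 1)/2, and the rest is
    half of \<open>?one\<close>.\<close>
  also have "\<dots> = (\<Sum>n. ennreal ((1 / 2) ^ Suc (n + 1)) * ennreal (exp (t / (real (n + 1) + 1)) - 1)) +
      ennreal (1 / 2) * ennreal (exp t - 1)"
    by (subst suminf_offset[where i = 1]) (auto intro: summableI)
  also have "(\<Sum>n. ennreal ((1 / 2) ^ Suc (n + 1)) * ennreal (exp (t / (real (n + 1) + 1)) - 1)) =
      (\<Sum>n. ennreal (1 / 2) * (ennreal ((1 / 2) ^ Suc n) * ennreal (exp (t / (real n + 2)) - 1)))"
  proof (intro suminf_cong)
    fix n
    have "ennreal ((1 / 2) ^ Suc (n + 1)) = ennreal (1 / 2) * ennreal ((1 / 2) ^ Suc n)"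
      by (subst ennreal_mult[symmetric]) simp_all
    then show "ennreal ((1 / 2) ^ Suc (n + 1)) * ennreal (exp (t / (real (n + 1) + 1)) - 1) =
      ennreal (1 / 2) * (ennreal ((1 / 2) ^ Suc n) * ennreal (exp (t / (real n + 2)) - 1))"
      by (simp add: mult.assoc add.commute del: power_Suc)
  qed
  also have "\<dots> = ennreal (1 / 2) * ?one" unfolding ennreal_suminf_cmult one ..
  \<comment> \<open>Giving up the factor 1/2 here makes \<open>?one\<close> cancel against the
    left-hand side.\<close>
  also have "\<dots> \<le> 1 * ?one" by (intro mult_right_mono)
    (auto intro: ennreal_leI simp flip: ennreal_1 simp del: ennreal_half)
  finally have "?h + ?one \<le> ?one + ennreal (1 / 2) * ennreal (exp t - 1)"
    unfolding split by (simp add: add_right_mono)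
  then show ?thesis using fin by (simp add: add.commute[of _ ?one] ennreal_add_left_cancel_le)
qed

text \<open>The first application only replaces exp s by exp s - 1; every further one halves. The
  constant 2 pays for the first application.\<close>

lemma qm_op_pow_exp_le:
  assumes "0 < t"
  shows "(qm_op ^^ n) (\<lambda>s. ennreal (exp s)) t \<le> ennreal (2 * (1 / 2) ^ n) * ennreal (exp t)"
proof -
  have *: "(qm_op ^^ Suc n) (\<lambda>s. ennreal (exp s)) t \<le> ennreal ((1 / 2) ^ n) * ennreal (exp t - 1)"
    if "0 < t" for t n
    using that
  proof (induction n arbitrary: t)
    case 0
    then show ?case using qm_op_exp_le[of t] by simp
  next
    case (Suc n)
    have "(qm_op ^^ Suc (Suc n)) (\<lambda>s. ennreal (exp s)) t =
        qm_op ((qm_op ^^ Suc n) (\<lambda>s. ennreal (exp s))) t" by simp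
    also have "\<dots> \<le> qm_op (\<lambda>s. ennreal ((1 / 2) ^ n) * ennreal (exp s - 1)) t"
      by (intro qm_op_mono Suc.IH)
    also have "\<dots> = ennreal ((1 / 2) ^ n) * qm_op (\<lambda>s. ennreal (exp s - 1)) t"
      by (simp add: qm_op_cmult)
    also have "\<dots> \<le> ennreal ((1 / 2) ^ n) * (ennreal (1 / 2) * ennreal (exp t - 1))"
      using Suc.prems by (intro mult_left_mono qm_op_expm1_le) auto
    also have "\<dots> = ennreal ((1 / 2) ^ Suc n) * ennreal (exp t - 1)"
      by (subst mult.assoc[symmetric], subst ennreal_mult[symmetric]) (simp_all add: mult.commute)
    finally show ?case .
  qed
  show ?thesis
  proof (cases n)
    case 0
    have "ennreal (exp t) \<le> ennreal (2 * exp t)" by (intro ennreal_leI) simp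
    then show ?thesis using 0 by (simp add: ennreal_mult)
  next
    case (Suc m)
    have "ennreal ((1 / 2) ^ m) * ennreal (exp t - 1) \<le> ennreal ((1 / 2) ^ m) * ennreal (exp t)"
      by (intro mult_left_mono ennreal_leI) auto
    then show ?thesis using *[OF assms, of m] Suc by (simp add: order_trans)
  qed
qed

subsection \<open>The Neumann series\<close>

definition qm_laplace :: "real \<Rightarrow> ennreal" where
  "qm_laplace t = (\<integral>\<^sup>+x. ennreal (exp (x * t)) \<partial>qm_measure)"

lemma borel_measurable_qm_laplace [measurable]: "qm_laplace \<in> borel_measurable borel"
proof -
  interpret prob_space qm_measure by (rule prob_space_qm_measure)
  show ?thesis unfolding qm_laplace_def[abs_def] by measurable
qed

lemma qm_laplace_le:
  assumes "0 \<le> t"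
  shows "qm_laplace t \<le> ennreal (exp t)"
proof -
  interpret prob_space qm_measure by (rule prob_space_qm_measure)
  have "qm_laplace t \<le> (\<integral>\<^sup>+x. ennreal (exp t) \<partial>qm_measure)"
    unfolding qm_laplace_def using AE_qm_measure
    by (intro nn_integral_mono_AE, eventually_elim)
       (use assms in \<open>auto intro!: ennreal_leI mult_left_le_one_le\<close>)
  also have "\<dots> = ennreal (exp t)" by (simp add: emeasure_space_1)
  finally show ?thesis .
qed

text \<open>Tonelli: operators with a positive kernel need to be computed on exponentials
  only.\<close>

lemma nn_integral_qm_laplace:
  assumes [measurable]: "k \<in> borel_measurable borel"
  shows "(\<integral>\<^sup>+s. k s * qm_laplace s \<partial>lborel) =
    (\<integral>\<^sup>+x. (\<integral>\<^sup>+s. k s * ennreal (exp (x * s)) \<partial>lborel) \<partial>qm_measure)"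
proof -
  interpret prob_space qm_measure by (rule prob_space_qm_measure)
  interpret pair_sigma_finite qm_measure lborel by standard
  have "(\<integral>\<^sup>+s. k s * qm_laplace s \<partial>lborel) =
      (\<integral>\<^sup>+s. (\<integral>\<^sup>+x. k s * ennreal (exp (x * s)) \<partial>qm_measure) \<partial>lborel)"
    unfolding qm_laplace_def by (intro nn_integral_cong nn_integral_cmult[symmetric]) measurable
  also have "\<dots> = (\<integral>\<^sup>+x. (\<integral>\<^sup>+s. k s * ennreal (exp (x * s)) \<partial>lborel) \<partial>qm_measure)"
    by (rule Fubini') measurable
  finally show ?thesis .
qed

text \<open>Reflecting x in every branch turns n + 1 + x into n + 2 - x, the form in which the
  Laplace transforms of the kernel produce it.\<close>

lemma nn_integral_qm_measure_reflected_branches: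
  assumes [measurable]: "g \<in> borel_measurable borel"
  shows "(\<integral>\<^sup>+x. (\<Sum>n. ennreal ((1 / 2) ^ Suc n) * g (1 / (real n + 2 - x))) \<partial>qm_measure) =
    (\<integral>\<^sup>+x. g x \<partial>qm_measure)"
proof -
  have reflect: "(\<integral>\<^sup>+x. g (1 / (real n + 2 - x)) \<partial>qm_measure) =
      (\<integral>\<^sup>+x. g (1 / (real n + 1 + x)) \<partial>qm_measure)" for n
    using nn_integral_qm_measure_reflect[of "\<lambda>x. g (1 / (real n + 1 + x))"]
    by (simp add: algebra_simps)
  have "(\<integral>\<^sup>+x. (\<Sum>n. ennreal ((1 / 2) ^ Suc n) * g (1 / (real n + 2 - x))) \<partial>qm_measure) =
      (\<Sum>n. ennreal ((1 / 2) ^ Suc n) * (\<integral>\<^sup>+x. g (1 / (real n + 2 - x)) \<partial>qm_measure))"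
    by (subst nn_integral_suminf) (simp_all add: nn_integral_cmult del: power_Suc)
  then show ?thesis by (simp only: reflect nn_integral_qm_measure_branches[OF assms])
qed

text \<open>On exp(x s) the operator gives the digit average of exp(t/(n+2-x)) - 1. Integrated over
  x, self-similarity turns this into the integral of exp(x t) - 1, and the missing 1 is the total
  mass.\<close>

lemma qm_laplace_eq:
  assumes "0 \<le> t"
  shows "qm_laplace t = 1 + qm_op qm_laplace t"
proof -
  interpret prob_space qm_measure by (rule prob_space_qm_measure)
  have "qm_op qm_laplace t = (\<integral>\<^sup>+x. qm_op (\<lambda>s. ennreal (exp (x * s))) t \<partial>qm_measure)"
    unfolding qm_op_def by (rule nn_integral_qm_laplace) measurable
  also have "\<dots> = (\<integral>\<^sup>+x. (\<Sum>n. ennreal ((1 / 2) ^ Suc n) *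
      ennreal (exp (1 / (real n + 2 - x) * t) - 1)) \<partial>qm_measure)"
  proof (intro nn_integral_cong_AE)
    show "AE x in qm_measure. qm_op (\<lambda>s. ennreal (exp (x * s))) t =
      (\<Sum>n. ennreal ((1 / 2) ^ Suc n) * ennreal (exp (1 / (real n + 2 - x) * t) - 1))"
      using AE_qm_measure by eventually_elim (simp add: qm_op_exp[OF assms] del: power_Suc)
  qed
  also have "\<dots> = (\<integral>\<^sup>+x. ennreal (exp (x * t) - 1) \<partial>qm_measure)"
    by (rule nn_integral_qm_measure_reflected_branches) measurable
  finally have op: "qm_op qm_laplace t = (\<integral>\<^sup>+x. ennreal (exp (x * t) - 1) \<partial>qm_measure)" .
  have "qm_laplace t = (\<integral>\<^sup>+x. 1 + ennreal (exp (x * t) - 1) \<partial>qm_measure)"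
    unfolding qm_laplace_def
  proof (intro nn_integral_cong_AE)
    show "AE x in qm_measure. ennreal (exp (x * t)) = 1 + ennreal (exp (x * t) - 1)"
      using AE_qm_measure
    proof eventually_elim
      case (elim x)
      then have "1 \<le> exp (x * t)" using assms by simp
      then show ?case by (subst ennreal_1[symmetric], subst ennreal_plus[symmetric]) auto
    qed
  qed
  also have "\<dots> = 1 + qm_op qm_laplace t"
    unfolding op by (subst nn_integral_add) (simp_all add: emeasure_space_1)
  finally show ?thesis .
qed

lemma qm_op_pow_laplace:
  assumes "0 < t"
  shows "(qm_op ^^ n) qm_laplace t =
    (qm_op ^^ n) (\<lambda>_. 1) t + (qm_op ^^ Suc n) qm_laplace t"
  using assms
proof (induction n arbitrary: t)
  case 0
  then show ?case using qm_laplace_eq[of t] by simp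
next
  case (Suc n)
  have "(qm_op ^^ Suc n) qm_laplace t =
      qm_op (\<lambda>s. (qm_op ^^ n) (\<lambda>_. 1) s + (qm_op ^^ Suc n) qm_laplace s) t"
    unfolding funpow.simps(2) o_apply by (rule qm_op_cong) (use Suc.IH in simp)
  also have "\<dots> = qm_op ((qm_op ^^ n) (\<lambda>_. 1)) t + qm_op ((qm_op ^^ Suc n) qm_laplace) t"
    by (rule qm_op_add) (intro borel_measurable_qm_op_pow borel_measurable_qm_laplace
        borel_measurable_const)+
  finally show ?case by simp
qed

lemma qm_op_pow_mono:
  assumes "\<And>s. 0 < s \<Longrightarrow> \<phi> s \<le> \<psi> s" "0 < t"
  shows "(qm_op ^^ n) \<phi> t \<le> (qm_op ^^ n) \<psi> t"
  using assms(2)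
proof (induction n arbitrary: t)
  case (Suc n)
  then show ?case by (simp add: qm_op_mono)
qed (simp add: assms(1))

section \<open>Moments as values of a functional on the Laplace transform\<close>

definition qm_functional :: "nat \<Rightarrow> (real \<Rightarrow> ennreal) \<Rightarrow> ennreal" where
  "qm_functional m \<phi> =
    (\<integral>\<^sup>+s. ennreal (s ^ m * qm_weight s) * indicator {0<..} s * \<phi> s \<partial>lborel)"

lemma qm_functional_mono:
  assumes "\<And>s. 0 < s \<Longrightarrow> \<phi> s \<le> \<psi> s"
  shows "qm_functional m \<phi> \<le> qm_functional m \<psi>"
  unfolding qm_functional_def
  by (intro nn_integral_mono) (use assms in \<open>auto simp: indicator_def intro!: mult_left_mono\<close>)

lemma qm_functional_cong:
  assumes "\<And>s. 0 < s \<Longrightarrow> \<phi> s = \<psi> s"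
  shows "qm_functional m \<phi> = qm_functional m \<psi>"
  by (intro antisym qm_functional_mono) (simp_all add: assms)

lemma qm_functional_add:
  assumes [measurable]: "\<phi> \<in> borel_measurable borel" "\<psi> \<in> borel_measurable borel"
  shows "qm_functional m (\<lambda>s. \<phi> s + \<psi> s) = qm_functional m \<phi> + qm_functional m \<psi>"
  unfolding qm_functional_def by (simp add: distrib_left nn_integral_add)

lemma qm_functional_cmult:
  assumes [measurable]: "\<phi> \<in> borel_measurable borel"
  shows "qm_functional m (\<lambda>s. c * \<phi> s) = c * qm_functional m \<phi>"
  unfolding qm_functional_def by (subst nn_integral_cmult[symmetric]) (simp_all add: mult_ac)

lemma qm_functional_exp:
  assumes "x \<le> 1"
  shows "qm_functional m (\<lambda>s. ennreal (exp (x * s))) =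
    ennreal (fact m) * (\<Sum>n. ennreal ((1 / 2) ^ Suc n) * ennreal ((1 / (real n + 2 - x)) ^ Suc m))"
proof -
  have "qm_functional m (\<lambda>s. ennreal (exp (x * s))) =
      (\<Sum>n. ennreal ((1 / 2) ^ Suc n) * ennreal (fact m / (real n + 2 - x) ^ Suc m))"
    unfolding qm_functional_def using assms
    by (subst nn_integral_qm_weight_exp) (simp_all add: nn_integral_power_exp del: power_Suc)
  also have "\<dots> = (\<Sum>n. ennreal (fact m) *
      (ennreal ((1 / 2) ^ Suc n) * ennreal ((1 / (real n + 2 - x)) ^ Suc m)))"
  proof (intro suminf_cong)
    fix n
    have "ennreal (fact m / (real n + 2 - x) ^ Suc m) =
        ennreal (fact m) * ennreal ((1 / (real n + 2 - x)) ^ Suc m)"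
      by (subst ennreal_mult'[symmetric]) (simp_all add: power_one_over del: power_Suc)
    then show "ennreal ((1 / 2) ^ Suc n) * ennreal (fact m / (real n + 2 - x) ^ Suc m) =
        ennreal (fact m) * (ennreal ((1 / 2) ^ Suc n) * ennreal ((1 / (real n + 2 - x)) ^ Suc m))"
      by (simp only: mult.left_commute)
  qed
  finally show ?thesis by (simp only: ennreal_suminf_cmult)
qed

lemma qm_functional_exp_le: "qm_functional m (\<lambda>s. ennreal (exp s)) \<le> ennreal (fact m)"
proof -
  have "qm_functional m (\<lambda>s. ennreal (exp s)) \<le> ennreal (fact m) * 1"
    unfolding qm_functional_exp[of 1, unfolded mult_1, OF order_refl]
  proof (intro mult_left_mono suminf_half_le)
    fix n
    have "(1 / (real n + 2 - 1)) ^ Suc m \<le> 1" by (intro power_le_one) auto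
    then show "ennreal ((1 / (real n + 2 - 1)) ^ Suc m) \<le> 1"
      using ennreal_leI by fastforce
  qed simp
  then show ?thesis by simp
qed

text \<open>The Gamma integral at n + 2 - x gives \<open>fact m\<close> times the power m + 1 of a
  reflected branch, so self-similarity yields the moment of order m + 1.\<close>

lemma qm_functional_laplace:
  "qm_functional m qm_laplace = ennreal (fact m) * (\<integral>\<^sup>+x. ennreal (x ^ Suc m) \<partial>qm_measure)"
proof -
  have "qm_functional m qm_laplace =
      (\<integral>\<^sup>+x. qm_functional m (\<lambda>s. ennreal (exp (x * s))) \<partial>qm_measure)"
    unfolding qm_functional_def by (rule nn_integral_qm_laplace) measurable
  also have "\<dots> = (\<integral>\<^sup>+x. ennreal (fact m) * (\<Sum>n. ennreal ((1 / 2) ^ Suc n) *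
      ennreal ((1 / (real n + 2 - x)) ^ Suc m)) \<partial>qm_measure)"
  proof (intro nn_integral_cong_AE)
    show "AE x in qm_measure. qm_functional m (\<lambda>s. ennreal (exp (x * s))) = ennreal (fact m) *
      (\<Sum>n. ennreal ((1 / 2) ^ Suc n) * ennreal ((1 / (real n + 2 - x)) ^ Suc m))"
      using AE_qm_measure by eventually_elim (rule qm_functional_exp, simp)
  qed
  also have "\<dots> = ennreal (fact m) * (\<integral>\<^sup>+x. (\<Sum>n. ennreal ((1 / 2) ^ Suc n) *
      ennreal ((1 / (real n + 2 - x)) ^ Suc m)) \<partial>qm_measure)"
    by (rule nn_integral_cmult) measurable
  also have "(\<integral>\<^sup>+x. (\<Sum>n. ennreal ((1 / 2) ^ Suc n) *
      ennreal ((1 / (real n + 2 - x)) ^ Suc m)) \<partial>qm_measure) = (\<integral>\<^sup>+x. ennreal (x ^ Suc m) \<partial>qm_measure)"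
    by (rule nn_integral_qm_measure_reflected_branches[of "\<lambda>x. ennreal (x ^ Suc m)"]) measurable
  finally show ?thesis .
qed

text \<open>Iterating M = 1 + K M finitely often and keeping the remainder allows partial sums to be
  compared with the moment directly.\<close>

lemma qm_functional_laplace_expand:
  "qm_functional m qm_laplace = (\<Sum>l<n. qm_functional m ((qm_op ^^ l) (\<lambda>_. 1))) +
    qm_functional m ((qm_op ^^ n) qm_laplace)"
proof (induction n)
  case (Suc n)
  have "qm_functional m ((qm_op ^^ n) qm_laplace) =
      qm_functional m (\<lambda>s. (qm_op ^^ n) (\<lambda>_. 1) s + (qm_op ^^ Suc n) qm_laplace s)"
    by (rule qm_functional_cong) (rule qm_op_pow_laplace)
  also have "\<dots> = qm_functional m ((qm_op ^^ n) (\<lambda>_. 1)) +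
      qm_functional m ((qm_op ^^ Suc n) qm_laplace)"
    by (rule qm_functional_add) (intro borel_measurable_qm_op_pow borel_measurable_qm_laplace
        borel_measurable_const)+
  finally show ?case using Suc by (simp add: add.assoc)
qed simp

text \<open>Stated for any function below exp s, since it serves twice: with the constant 1 for the
  terms of the series and with \<open>qm_laplace\<close> for the remainder.\<close>

lemma qm_functional_pow_le:
  assumes "\<And>s. 0 < s \<Longrightarrow> \<phi> s \<le> ennreal (exp s)"
  shows "qm_functional m ((qm_op ^^ n) \<phi>) \<le> ennreal (2 * fact m * (1 / 2) ^ n)"
proof -
  have "qm_functional m ((qm_op ^^ n) \<phi>) \<le>
      qm_functional m (\<lambda>s. ennreal (2 * (1 / 2) ^ n) * ennreal (exp s))"
    using order_trans[OF qm_op_pow_mono[OF assms] qm_op_pow_exp_le]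
    by (intro qm_functional_mono) blast
  also have "\<dots> = ennreal (2 * (1 / 2) ^ n) * qm_functional m (\<lambda>s. ennreal (exp s))"
    by (rule qm_functional_cmult) measurable
  also have "\<dots> \<le> ennreal (2 * (1 / 2) ^ n) * ennreal (fact m)"
    by (intro mult_left_mono qm_functional_exp_le) simp
  also have "\<dots> = ennreal (2 * fact m * (1 / 2) ^ n)"
    by (subst ennreal_mult[symmetric]) (simp_all add: mult_ac)
  finally show ?thesis .
qed

section \<open>Iterated integrals over the orthant as powers of the operator\<close>

definition qm_chain :: "nat \<Rightarrow> nat \<Rightarrow> (nat \<Rightarrow> real) \<Rightarrow> ennreal" where
  "qm_chain m l x = ennreal (x 0 ^ m * qm_weight (x 0)) * indicator {0<..} (x 0) *
     (\<Prod>i<l. qm_kernel (x i) (x (Suc i)))"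

text \<open>Integrating out the last variable replaces the test function by its image under
  \<open>qm_op\<close>; this is why the induction runs over arbitrary \<open>\<phi>\<close>.\<close>

lemma nn_integral_qm_chain:
  assumes "\<phi> \<in> borel_measurable borel"
  shows "(\<integral>\<^sup>+x. qm_chain m l x * \<phi> (x l) \<partial>lborel_n l) = qm_functional m ((qm_op ^^ l) \<phi>)"
  using assms
proof (induction l arbitrary: \<phi>)
  case 0
  note [measurable] = 0
  interpret product_sigma_finite "\<lambda>_::nat. lborel :: real measure" by standard
  show ?case
    using product_nn_integral_singleton[of
      "\<lambda>s. ennreal (s ^ m * qm_weight s) * indicator {0<..} s * \<phi> s" 0]
    by (simp add: qm_chain_def qm_functional_def)
next
  case (Suc l)
  note [measurable] = Suc.prems
  interpret product_sigma_finite "\<lambda>_::nat. lborel :: real measure" by standard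
  have ins: "{..Suc l} = insert (Suc l) {..l}" by (rule atMost_Suc)
  have "(\<integral>\<^sup>+x. qm_chain m (Suc l) x * \<phi> (x (Suc l)) \<partial>lborel_n (Suc l)) =
      (\<integral>\<^sup>+x. (\<integral>\<^sup>+y. qm_chain m (Suc l) (x(Suc l := y)) * \<phi> ((x(Suc l := y)) (Suc l)) \<partial>lborel)
        \<partial>lborel_n l)"
    unfolding ins
    by (rule product_nn_integral_insert) (simp_all add: qm_chain_def)
  also have "\<dots> = (\<integral>\<^sup>+x. qm_chain m l x * qm_op \<phi> (x l) \<partial>lborel_n l)"
  proof (intro nn_integral_cong)
    fix x :: "nat \<Rightarrow> real"
    have "qm_chain m (Suc l) (x(Suc l := y)) = qm_chain m l x * qm_kernel (x l) y" for y
      by (simp add: qm_chain_def mult.assoc)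
    then show "(\<integral>\<^sup>+y. qm_chain m (Suc l) (x(Suc l := y)) * \<phi> ((x(Suc l := y)) (Suc l)) \<partial>lborel) =
        qm_chain m l x * qm_op \<phi> (x l)"
      by (simp add: qm_op_def mult.assoc nn_integral_cmult)
  qed
  also have "\<dots> = qm_functional m ((qm_op ^^ l) (qm_op \<phi>))"
    by (rule Suc.IH) measurable
  finally show ?case by (simp add: funpow_swap1)
qed

text \<open>Interior variables occur in two consecutive roots and the two end variables in one. This
  supplies the square roots that cancel the factor (x_0 x_l)^(-1/2) of the integrand.\<close>

lemma prod_sqrt_consecutive:
  fixes x :: "nat \<Rightarrow> real"
  assumes "\<forall>i\<le>l. 0 \<le> x i"
  shows "(\<Prod>i<l. sqrt (x i * x (i + 1))) * sqrt (x 0) = (\<Prod>i<l. x i) * sqrt (x l)"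
  using assms
proof (induction l)
  case (Suc l)
  have "(\<Prod>i<Suc l. sqrt (x i * x (i + 1))) * sqrt (x 0) =
      ((\<Prod>i<l. sqrt (x i * x (i + 1))) * sqrt (x 0)) * (sqrt (x l) * sqrt (x (Suc l)))"
    by (simp add: real_sqrt_mult mult_ac)
  also have "\<dots> = (\<Prod>i<l. x i) * (sqrt (x l) * sqrt (x l)) * sqrt (x (Suc l))"
    using Suc by simp
  also have "\<dots> = (\<Prod>i<Suc l. x i) * sqrt (x (Suc l))" using Suc.prems by simp
  finally show ?case .
qed simp

text \<open>Each Bessel factor is a square root times \<open>bessel_core\<close>. The roots, the
  factor (x_0 x_l)^(-1/2) and one power of x_0 combine to the product of the x_i with i < l, which
  are the factors t of the kernels.\<close>

lemma moment_integrand_pos: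
  assumes x: "\<And>i. i \<le> l \<Longrightarrow> 0 < x i"
  shows "moment_integrand (Suc m) l x = x 0 ^ m * qm_weight (x 0) *
    (\<Prod>i<l. x i * bessel_core (x i * x (Suc i)) * qm_weight (x (Suc i)))"
proof -
  have pos: "0 < x 0" "0 < x l" using x by simp_all
  let ?B = "\<Prod>i<l. bessel_core (x i * x (Suc i))"
  have bessel: "(\<Prod>i<l. bessel_I1 (2 * sqrt (x i * x (i + 1)))) =
      (\<Prod>i<l. sqrt (x i * x (i + 1))) * ?B"
    unfolding prod.distrib[symmetric]
  proof (intro prod.cong refl)
    fix i assume "i \<in> {..<l}"
    then have "0 \<le> x i * x (i + 1)" using x[of i] x[of "i + 1"] by simp
    then show "bessel_I1 (2 * sqrt (x i * x (i + 1))) =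
        sqrt (x i * x (i + 1)) * bessel_core (x i * x (Suc i))"
      using bessel_I1_sqrt by simp
  qed
  have powr: "(x 0 * x l) powr (-1/2) = 1 / (sqrt (x 0) * sqrt (x l))"
  proof -
    have "(x 0 * x l) powr (-1/2) = inverse ((x 0 * x l) powr (1 / 2))"
      using powr_minus[of "x 0 * x l" "1 / 2"] by simp
    also have "\<dots> = inverse (sqrt (x 0 * x l))" using pos by (simp add: powr_half_sqrt)
    finally show ?thesis by (simp add: real_sqrt_mult inverse_eq_divide)
  qed
  have weights: "1 / (\<Prod>i\<le>l. exp (x i) * (2 * exp (x i) - 1)) =
      qm_weight (x 0) * (\<Prod>i<l. qm_weight (x (Suc i)))"
    unfolding qm_weight_def prod.atMost_shift by (simp add: prod_dividef)
  have "x 0 ^ Suc m * ((x 0 * x l) powr (-1/2) * (\<Prod>i<l. sqrt (x i * x (i + 1)))) =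
      x 0 ^ m * (\<Prod>i<l. x i)"
  proof -
    have "(\<Prod>i<l. sqrt (x i * x (i + 1))) = (\<Prod>i<l. x i) * sqrt (x l) / sqrt (x 0)"
      using prod_sqrt_consecutive[of l x] less_imp_le[OF x] pos by (simp add: nonzero_eq_divide_eq)
    then have "x 0 ^ Suc m * ((x 0 * x l) powr (-1/2) * (\<Prod>i<l. sqrt (x i * x (i + 1)))) =
        x 0 ^ m * (\<Prod>i<l. x i) * (x 0 / (sqrt (x 0) * sqrt (x 0)))"
      using pos unfolding powr by simp
    then show ?thesis using pos by simp
  qed
  then have "moment_integrand (Suc m) l x = x 0 ^ m * (\<Prod>i<l. x i) * ?B *
      (1 / (\<Prod>i\<le>l. exp (x i) * (2 * exp (x i) - 1)))"
    unfolding moment_integrand_def bessel by (simp add: mult.assoc[symmetric])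
  then show ?thesis unfolding weights by (simp add: prod.distrib mult_ac)
qed

text \<open>For i < l a Bessel factor vanishes, as I_1(0) = 0. For i = l the convention
  \<open>0 powr a = 0\<close> makes the singular factor vanish.\<close>

lemma moment_integrand_zero:
  assumes "i \<le> l" "x i = 0"
  shows "moment_integrand (Suc m) l x = 0"
proof -
  have "bessel_I1 0 = 0" using bessel_I1_sqrt[of 0] by simp
  then have "i < l \<Longrightarrow> (\<Prod>i<l. bessel_I1 (2 * sqrt (x i * x (i + 1)))) = 0"
    using assms by (intro prod_zero bexI[of _ i]) auto
  then show ?thesis using assms by (cases "i < l") (auto simp: moment_integrand_def)
qed

lemma moment_integrand_nonneg:
  assumes "x \<in> orthant l"
  shows "0 \<le> moment_integrand (Suc m) l x"
proof (cases "\<forall>i\<le>l. 0 < x i")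
  case True
  then have "\<forall>i\<le>l. 0 \<le> x i" by (simp add: less_imp_le)
  then show ?thesis using True
    by (subst moment_integrand_pos)
       (auto intro!: mult_nonneg_nonneg prod_nonneg qm_weight_nonneg bessel_core_nonneg)
next
  case False
  then obtain i where "i \<le> l" "\<not> 0 < x i" by blast
  moreover have "0 \<le> x i" using assms \<open>i \<le> l\<close> by (auto simp: PiE_iff)
  ultimately show ?thesis using moment_integrand_zero[of i l x m] by simp
qed

text \<open>The equality is pointwise, not just almost everywhere: if some coordinate is not
  positive, both sides are 0, on the faces of the orthant by
  \<open>moment_integrand_zero\<close>.\<close>

lemma moment_integrand_eq_chain:
  assumes "x \<in> space (lborel_n l)"
  shows "ennreal (indicator (orthant l) x * moment_integrand (Suc m) l x) = qm_chain m l x"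
proof (cases "\<forall>i\<le>l. 0 < x i")
  case True
  then have x: "\<And>i. i \<le> l \<Longrightarrow> 0 < x i" by blast
  have "x \<in> orthant l" using assms x by (auto simp: space_PiM PiE_iff less_imp_le)
  moreover have "(\<Prod>i<l. qm_kernel (x i) (x (Suc i))) =
      (\<Prod>i<l. ennreal (x i * bessel_core (x i * x (Suc i)) * qm_weight (x (Suc i))))"
    using x by (intro prod.cong) (simp_all add: qm_kernel_def)
  moreover have "\<dots> = ennreal (\<Prod>i<l. x i * bessel_core (x i * x (Suc i)) * qm_weight (x (Suc i)))"
    using less_imp_le[OF x]
    by (intro prod_ennreal) (auto intro!: mult_nonneg_nonneg qm_weight_nonneg bessel_core_nonneg)
  moreover have "0 \<le> x 0 ^ m * qm_weight (x 0)"
    using x[of 0] by (auto intro!: mult_nonneg_nonneg qm_weight_nonneg)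
  ultimately show ?thesis
    using x[of 0] by (simp add: moment_integrand_pos[OF x] qm_chain_def ennreal_mult')
next
  case False
  then obtain i where i: "i \<le> l" "x i \<le> 0" by (auto simp: not_less)
  have "qm_chain m l x = 0"
  proof (cases i)
    case 0
    then show ?thesis using i by (simp add: qm_chain_def)
  next
    case (Suc j)
    then have "(\<Prod>i<l. qm_kernel (x i) (x (Suc i))) = 0"
      using i by (intro prod_zero bexI[of _ j]) (auto simp: qm_kernel_def)
    then show ?thesis by (simp add: qm_chain_def)
  qed
  moreover have "indicator (orthant l) x * moment_integrand (Suc m) l x = 0"
  proof (cases "x i = 0")
    case False
    then have "\<not> 0 \<le> x i" using i by simp
    then have "x \<notin> orthant l" using i(1) by (auto simp: PiE_iff)
    then show ?thesis by simp
  qed (simp add: moment_integrand_zero[OF i(1)])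
  ultimately show ?thesis by (simp only: ennreal_0)
qed

section \<open>Integrability, size and sum of the terms\<close>

lemma borel_measurable_moment_integrand [measurable]:
  "moment_integrand L l \<in> borel_measurable (lborel_n l)"
  unfolding moment_integrand_def[abs_def] by measurable

lemma sets_orthant [measurable]: "orthant l \<in> sets (lborel_n l)"
  by (rule sets_PiM_I_finite) auto

lemma set_integrable_moment_integrand:
  "set_integrable (lborel_n l) (orthant l) (moment_integrand (Suc m) l)" (is ?int)
  and moment_term_eq: "ennreal (moment_term (Suc m) l) = qm_functional m ((qm_op ^^ l) (\<lambda>_. 1))"
    (is ?eq)
  and moment_term_nonneg: "0 \<le> moment_term (Suc m) l" (is ?nonneg)
proof -
  let ?f = "\<lambda>x. indicator (orthant l) x * moment_integrand (Suc m) l x"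
  have nonneg: "0 \<le> ?f x" for x
    using moment_integrand_nonneg[of x l m] by (simp add: indicator_def)
  have nn: "(\<integral>\<^sup>+x. ennreal (?f x) \<partial>lborel_n l) = qm_functional m ((qm_op ^^ l) (\<lambda>_. 1))"
    using nn_integral_qm_chain[of "\<lambda>_. 1", where m = m and l = l]
    by (simp add: moment_integrand_eq_chain cong: nn_integral_cong)
  have "(1::ennreal) \<le> ennreal (exp s)" if "0 < s" for s
    using that ennreal_leI[of 1 "exp s"] by simp
  then have "qm_functional m ((qm_op ^^ l) (\<lambda>_. 1)) \<le> ennreal (2 * fact m * (1 / 2) ^ l)"
    by (rule qm_functional_pow_le)
  then have "(\<integral>\<^sup>+x. ennreal (?f x) \<partial>lborel_n l) < \<infinity>"
    unfolding nn using ennreal_less_top le_less_trans by (metis infinity_ennreal_def)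
  then have int: "integrable (lborel_n l) ?f"
    by (intro integrableI_nonneg) (use nonneg in auto)
  then show ?int by (simp add: set_integrable_def)
  have "moment_term (Suc m) l = integral\<^sup>L (lborel_n l) ?f"
    by (simp add: moment_term_def set_lebesgue_integral_def)
  then show ?eq ?nonneg
    using nn_integral_eq_integral[OF int] nonneg nn by simp_all
qed

lemma moment_term_le: "moment_term (Suc m) l \<le> 2 * fact m * (1 / 2) ^ l"
proof -
  have "(1::ennreal) \<le> ennreal (exp s)" if "0 < s" for s
    using that ennreal_leI[of 1 "exp s"] by simp
  then have "ennreal (moment_term (Suc m) l) \<le> ennreal (2 * fact m * (1 / 2) ^ l)"
    unfolding moment_term_eq by (rule qm_functional_pow_le)
  then show ?thesis by (subst (asm) ennreal_le_iff) auto
qed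

text \<open>The finite expansion writes \<open>fact m\<close> times the moment as a partial sum plus
  a nonnegative remainder of size at most 2 m! (1/2)^n, which tends to 0.\<close>

lemma moment_term_sums:
  "moment_term (Suc m) sums (fact m * integral {0..1} (\<lambda>u. qm_inv u ^ Suc m))"
proof -
  let ?M = "integral {0..1} (\<lambda>u. qm_inv u ^ Suc m)"
  let ?S = "\<lambda>n. \<Sum>l<n. moment_term (Suc m) l"
  have M: "0 \<le> ?M" by (rule integral_nonneg)
    (auto intro!: integrable_continuous_interval continuous_intros continuous_on_qm_inv qm_inv_bounds
      zero_le_power simp del: power_Suc)
  have bound: "norm (?S n - fact m * ?M) \<le> 2 * fact m * (1 / 2) ^ n" for n
  proof -
    let ?R = "qm_functional m ((qm_op ^^ n) qm_laplace)"
    have R: "?R \<le> ennreal (2 * fact m * (1 / 2) ^ n)"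
      using qm_laplace_le by (intro qm_functional_pow_le) simp
    then obtain r where r: "?R = ennreal r" "0 \<le> r"
      by (metis ennreal_cases ennreal_less_top not_le)
    have "ennreal (fact m * ?M) = ennreal (fact m) * (\<integral>\<^sup>+x. ennreal (x ^ Suc m) \<partial>qm_measure)"
      using M by (subst nn_integral_qm_measure_eq_integral)
        (auto intro!: continuous_intros zero_le_power simp: ennreal_mult simp del: power_Suc)
    also have "\<dots> = (\<Sum>l<n. ennreal (moment_term (Suc m) l)) + ?R"
      unfolding qm_functional_laplace[symmetric] moment_term_eq by (rule qm_functional_laplace_expand)
    also have "\<dots> = ennreal (?S n + r)"
      using r by (simp add: sum_ennreal moment_term_nonneg sum_nonneg)
    finally have "fact m * ?M = ?S n + r"
      using M r by (subst (asm) ennreal_inj) (auto intro!: sum_nonneg add_nonneg_nonneg moment_term_nonneg)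
    moreover have "r \<le> 2 * fact m * (1 / 2) ^ n"
      using R unfolding r(1) by (subst (asm) ennreal_le_iff) auto
    ultimately show ?thesis using r(2) by simp
  qed
  have "(\<lambda>n. 2 * fact m * (1 / 2) ^ n :: real) \<longlonglongrightarrow> 2 * fact m * 0"
    by (intro tendsto_mult_left LIMSEQ_realpow_zero) auto
  then have "(\<lambda>n. 2 * fact m * (1 / 2) ^ n :: real) \<longlonglongrightarrow> 0" by (simp only: mult_zero_right)
  then have "(\<lambda>n. ?S n - fact m * ?M) \<longlonglongrightarrow> 0"
    by (rule Lim_null_comparison[OF always_eventually[OF allI[OF bound]]])
  then show ?thesis unfolding sums_def by (simp add: LIM_zero_iff)
qed

theorem theorem1:
  fixes L :: nat
  assumes "L \<ge> 1"
  shows "(\<forall>l. set_integrable (lborel_n l) (orthant l) (moment_integrand L l)) \<and>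
         summable (moment_term L) \<and>
         has_rs_integral (\<lambda>x. x ^ L) minkowski_qm 0 1
           (1 / fact (L - 1) * (\<Sum>l. moment_term L l)) \<and>
         (\<exists>C. \<forall>l. \<bar>moment_term L l\<bar> \<le> C * (1 / 2) ^ l)"
proof -
  obtain m where L: "L = Suc m" using assms by (cases L) auto
  have "1 / fact m * (\<Sum>l. moment_term L l) = integral {0..1} (\<lambda>u. qm_inv u ^ L)"
    using moment_term_sums[of m] unfolding L by (simp add: sums_iff del: power_Suc)
  then have "has_rs_integral (\<lambda>x. x ^ L) minkowski_qm 0 1
      (1 / fact (L - 1) * (\<Sum>l. moment_term L l))"
    using has_rs_integral_minkowski_qm[of "\<lambda>x. x ^ L"] L by (simp add: continuous_intros)
  moreover have "\<bar>moment_term L l\<bar> \<le> (2 * fact m) * (1 / 2) ^ l" for l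
    using moment_term_nonneg[of m l] moment_term_le[of m l] L by simp
  moreover have "summable (moment_term L)" using moment_term_sums[of m] L by (simp add: sums_iff)
  moreover have "set_integrable (lborel_n l) (orthant l) (moment_integrand L l)" for l
    unfolding L by (rule set_integrable_moment_integrand)
  ultimately show ?thesis by blast
qed

end
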